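(* Let $G$ be a quadrangulation graph with $n\geq 4$ vertices. Then \[ W(G)\leq \begin{cases} \frac{1}{12}n^3+\frac{7}{6}n-2, & \text{if } n\equiv 0 \pmod 2,\\[2pt] \frac{1}{12}n^3+\frac{11}{12}n-1, & \text{if } n\equiv 1 \pmod 2. \end{cases} \]
   Context: All graphs are finite, simple and connected. A quadrangulation graph is a simple plane graph (a planar graph together with a fixed embedding in the plane) in which every face, including the unbounded one, is bounded by a cycle of length 4. For a connected graph $G$, $d_G(u,v)$ denotes the length of a shortest path between $u$ and $v$, and the Wiener index is $W(G)=\sum_{\{u,v\}\subseteq V(G)} d_G(u,v)$, the sum over all unordered pairs of distinct vertices. *)

theory Defs
  imports Complex_Main
begin

text \<open>A finite simple graph is given by a finite vertex set V and a symmetric,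
irreflexive edge relation E (a set of darts, i.e. ordered pairs) on V.
Each undirected edge {u,v} corresponds to the two darts (u,v) and (v,u).\<close>

definition simple_graph :: "'a set \<Rightarrow> ('a \<times> 'a) set \<Rightarrow> bool" where
  "simple_graph V E \<longleftrightarrow> finite V \<and> E \<subseteq> V \<times> V \<and>
     (\<forall>u v. (u, v) \<in> E \<longrightarrow> (v, u) \<in> E) \<and> (\<forall>v. (v, v) \<notin> E)"

fun is_walk :: "('a \<times> 'a) set \<Rightarrow> 'a list \<Rightarrow> bool" where
  "is_walk E [] = False"
| "is_walk E [v] = True"
| "is_walk E (u # v # xs) = ((u, v) \<in> E \<and> is_walk E (v # xs))"

definition walk_betw :: "('a \<times> 'a) set \<Rightarrow> 'a \<Rightarrow> 'a \<Rightarrow> 'a list \<Rightarrow> bool" where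
  "walk_betw E u v xs \<longleftrightarrow> is_walk E xs \<and> hd xs = u \<and> last xs = v"

definition connected_graph :: "'a set \<Rightarrow> ('a \<times> 'a) set \<Rightarrow> bool" where
  "connected_graph V E \<longleftrightarrow> V \<noteq> {} \<and> (\<forall>u\<in>V. \<forall>v\<in>V. \<exists>xs. walk_betw E u v xs)"

definition dist :: "('a \<times> 'a) set \<Rightarrow> 'a \<Rightarrow> 'a \<Rightarrow> nat" where
  "dist E u v = (LEAST k. \<exists>xs. walk_betw E u v xs \<and> length xs = Suc k)"

text \<open>Wiener index: sum of distances over unordered pairs of distinct vertices,
written as half the sum over ordered pairs (dist u u = 0).\<close>
definition wiener :: "'a set \<Rightarrow> ('a \<times> 'a) set \<Rightarrow> real" where
  "wiener V E = (\<Sum>u\<in>V. \<Sum>v\<in>V. real (dist E u v)) / 2"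

text \<open>Plane embeddings, combinatorially (Heffter--Edmonds): a rotation system
\<sigma> is a permutation of the darts which, at every vertex, cyclically permutes
the darts leaving that vertex.  The faces are the orbits of the face permutation
d \<mapsto> \<sigma>(reverse d).  For a connected graph, the embedding is in the sphere
(plane) iff Euler's formula V - E + F = 2 holds.\<close>

definition rotation_system :: "('a \<times> 'a) set \<Rightarrow> ('a \<times> 'a \<Rightarrow> 'a \<times> 'a) \<Rightarrow> bool" where
  "rotation_system E \<sigma> \<longleftrightarrow> bij_betw \<sigma> E E \<and> (\<forall>d\<in>E. fst (\<sigma> d) = fst d) \<and>
     (\<forall>d\<in>E. \<forall>d'\<in>E. fst d = fst d' \<longrightarrow> (\<exists>k. (\<sigma> ^^ k) d = d'))"

definition face_perm :: "('a \<times> 'a \<Rightarrow> 'a \<times> 'a) \<Rightarrow> 'a \<times> 'a \<Rightarrow> 'a \<times> 'a" where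
  "face_perm \<sigma> d = \<sigma> (snd d, fst d)"

definition face_of :: "('a \<times> 'a \<Rightarrow> 'a \<times> 'a) \<Rightarrow> 'a \<times> 'a \<Rightarrow> ('a \<times> 'a) set" where
  "face_of \<sigma> d = {(face_perm \<sigma> ^^ k) d | k. True}"

definition faces :: "('a \<times> 'a) set \<Rightarrow> ('a \<times> 'a \<Rightarrow> 'a \<times> 'a) \<Rightarrow> ('a \<times> 'a) set set" where
  "faces E \<sigma> = face_of \<sigma> ` E"

definition plane_embedding :: "'a set \<Rightarrow> ('a \<times> 'a) set \<Rightarrow> ('a \<times> 'a \<Rightarrow> 'a \<times> 'a) \<Rightarrow> bool" where
  "plane_embedding V E \<sigma> \<longleftrightarrow> rotation_system E \<sigma> \<and>
     int (card V) - int (card E div 2) + int (card (faces E \<sigma>)) = 2"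

definition all_faces_4cycles :: "('a \<times> 'a) set \<Rightarrow> ('a \<times> 'a \<Rightarrow> 'a \<times> 'a) \<Rightarrow> bool" where
  "all_faces_4cycles E \<sigma> \<longleftrightarrow> (\<forall>d\<in>E. (face_perm \<sigma> ^^ 4) d = d \<and>
     inj_on (\<lambda>i. fst ((face_perm \<sigma> ^^ i) d)) {0..<4})"

definition quadrangulation :: "'a set \<Rightarrow> ('a \<times> 'a) set \<Rightarrow> bool" where
  "quadrangulation V E \<longleftrightarrow> simple_graph V E \<and> connected_graph V E \<and>
     (\<exists>\<sigma>. plane_embedding V E \<sigma> \<and> all_faces_4cycles E \<sigma>)"

end

theory Submission
  imports Defs
begin

text \<open>The only consequences of the embedding that matter are that the graph is bipartite and
\<^emph>\<open>linked\<close>: cyclically consecutive neighbours of a vertex have a second common neighbour, so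
the neighbours of \<open>v\<close>, joined when they have a common neighbour other than \<open>v\<close>, form a
2-connected graph. For linked bipartite graphs the bound is proved by induction on the number \<open>n\<close>
of vertices. Deleting one side of a 2-vertex separation \<open>{x, y}\<close> leaves a linked graph whose
distances are not smaller than the original ones.

If there is no such separation, all distance layers have at least 3 vertices, which bounds every
distance sum by \<open>n (n + 1) / 6\<close>, and at least half of the vertices do better by about \<open>n / 3\<close>.
A vertex of degree 2 is deleted when its distance sum permits; otherwise \<open>n\<close> is odd, the layers
around it have size exactly 2 up to a layer of size at least 3, and the graph is cut just before
that layer. In the remaining case the graph is cut along a separation with smallest side \<open>C\<close>;
then the layers of \<open>C\<close> around \<open>{x, y}\<close> have at least 3 vertices, which pays for the pairs of
vertices on different sides that are nearer to different ones of \<open>x\<close> and \<open>y\<close>.\<close>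

section \<open>Distances in connected graphs\<close>

lemma walk_betw_iff_relpow:
  "(\<exists>xs. walk_betw E u v xs \<and> length xs = Suc k) \<longleftrightarrow> (u, v) \<in> E ^^ k"
proof (induction k arbitrary: u)
  case 0
  have "walk_betw E u v [u]" if "u = v" using that by (simp add: walk_betw_def)
  moreover have "u = v" if "walk_betw E u v xs" "length xs = Suc 0" for xs
    using that by (auto simp: walk_betw_def length_Suc_conv)
  ultimately show ?case by (auto intro: exI[of _ "[u]"])
next
  case (Suc k)
  show ?case
  proof
    assume "\<exists>xs. walk_betw E u v xs \<and> length xs = Suc (Suc k)"
    then obtain a b ys where "walk_betw E u v (a # b # ys)" "length ys = k"
      by (auto simp: length_Suc_conv)
    then have "(u, b) \<in> E" "walk_betw E b v (b # ys)" "length (b # ys) = Suc k"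
      by (auto simp: walk_betw_def)
    then show "(u, v) \<in> E ^^ Suc k" using Suc.IH by (blast intro: relpow_Suc_I2)
  next
    assume "(u, v) \<in> E ^^ Suc k"
    then obtain b where b: "(u, b) \<in> E" "(b, v) \<in> E ^^ k" by (meson relpow_Suc_D2)
    then obtain xs where xs: "walk_betw E b v xs" "length xs = Suc k" using Suc.IH by blast
    then obtain ys where "xs = b # ys" by (cases xs) (auto simp: walk_betw_def)
    then have "walk_betw E u v (u # xs)" using xs b by (auto simp: walk_betw_def)
    then show "\<exists>xs. walk_betw E u v xs \<and> length xs = Suc (Suc k)"
      using xs by (intro exI[of _ "u # xs"]) simp
  qed
qed

lemma dist_eq_Least_relpow: "dist E u v = (LEAST k. (u, v) \<in> E ^^ k)"
  by (simp add: dist_def walk_betw_iff_relpow)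

lemma connected_graph_iff_rtrancl:
  "connected_graph V E \<longleftrightarrow> V \<noteq> {} \<and> (\<forall>u\<in>V. \<forall>v\<in>V. (u, v) \<in> E\<^sup>*)"
proof -
  have "(\<exists>xs. walk_betw E u v xs) \<longleftrightarrow> (\<exists>k. (u, v) \<in> E ^^ k)" for u v
  proof -
    have "length xs = Suc (length xs - 1)" if "walk_betw E u v xs" for xs
      using that by (cases xs) (auto simp: walk_betw_def)
    then show ?thesis by (metis walk_betw_iff_relpow)
  qed
  then show ?thesis by (simp add: connected_graph_def rtrancl_is_UN_relpow)
qed

lemma connected_graphI:
  assumes "simple_graph V E" and "V \<noteq> {}"
    and closed: "\<And>A. A \<subseteq> V \<Longrightarrow> A \<noteq> {} \<Longrightarrow> E `` A \<subseteq> A \<Longrightarrow> A = V"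
  shows "connected_graph V E"
  unfolding connected_graph_iff_rtrancl
proof (intro conjI ballI)
  fix u v assume "u \<in> V" "v \<in> V"
  have "w \<in> V" if "(u, w) \<in> E\<^sup>*" for w
    using that by induction (use \<open>u \<in> V\<close> assms(1) in \<open>auto simp: simple_graph_def\<close>)
  then have "E\<^sup>* `` {u} = V"
    by (intro closed) (auto intro: rtrancl_into_rtrancl)
  then show "(u, v) \<in> E\<^sup>*" using \<open>v \<in> V\<close> by blast
qed fact

locale connected_simple_graph =
  fixes V :: "'a set" and E :: "('a \<times> 'a) set"
  assumes simple: "simple_graph V E" and connected: "connected_graph V E"
begin

abbreviation nbrs :: "'a \<Rightarrow> 'a set" where "nbrs v \<equiv> E `` {v}"

lemma finite_V [simp]: "finite V" using simple by (simp add: simple_graph_def)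
lemma finite_subset_V: "A \<subseteq> V \<Longrightarrow> finite A" using finite_V finite_subset by blast
lemma edge_sym: "(u, v) \<in> E \<Longrightarrow> (v, u) \<in> E" using simple by (auto simp: simple_graph_def)
lemma edge_in_V: "(u, v) \<in> E \<Longrightarrow> u \<in> V \<and> v \<in> V" using simple by (auto simp: simple_graph_def)
lemma edge_irrefl [simp]: "(u, u) \<notin> E" using simple by (auto simp: simple_graph_def)
lemma nbrs_subset_V: "nbrs v \<subseteq> V" using edge_in_V by auto
lemma finite_nbrs [simp]: "finite (nbrs v)" using nbrs_subset_V by (rule finite_subset_V)

lemma card_V_pos: "v \<in> V \<Longrightarrow> 1 \<le> card V"
  using card_gt_0_iff[of V] finite_V by fastforce

lemma closed_eq_V:
  assumes "A \<subseteq> V" "A \<noteq> {}" "E `` A \<subseteq> A"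
  shows "A = V"
proof -
  obtain a where "a \<in> A" using assms by auto
  then have "(a, v) \<in> E\<^sup>*" if "v \<in> V" for v
    using connected that assms(1) by (auto simp: connected_graph_iff_rtrancl)
  moreover have "E\<^sup>* `` {a} \<subseteq> A"
    using Image_closed_trancl[OF assms(3)] \<open>a \<in> A\<close> by blast
  ultimately show ?thesis using assms(1) by blast
qed

lemma relpow_dist:
  assumes "u \<in> V" "v \<in> V"
  shows "(u, v) \<in> E ^^ dist E u v"
proof -
  have "\<exists>k. (u, v) \<in> E ^^ k"
    using connected assms by (simp add: connected_graph_iff_rtrancl rtrancl_is_UN_relpow)
  then show ?thesis unfolding dist_eq_Least_relpow by (rule LeastI_ex)
qed

lemma dist_le: "(u, v) \<in> E ^^ k \<Longrightarrow> dist E u v \<le> k"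
  unfolding dist_eq_Least_relpow by (rule Least_le)

lemma dist_refl [simp]: "dist E u u = 0"
  using dist_le[of u u 0] by simp

lemma relpow_sym: "(u, v) \<in> E ^^ k \<Longrightarrow> (v, u) \<in> E ^^ k"
proof (induction k arbitrary: v)
  case (Suc k)
  then obtain w where "(u, w) \<in> E ^^ k" "(w, v) \<in> E" by auto
  then show ?case using Suc.IH edge_sym by (blast intro: relpow_Suc_I2)
qed simp

lemma dist_commute: "dist E u v = dist E v u"
proof -
  have "(u, v) \<in> E ^^ k \<longleftrightarrow> (v, u) \<in> E ^^ k" for k using relpow_sym by blast
  then show ?thesis by (simp add: dist_eq_Least_relpow)
qed

lemma dist_eq_0_iff: "u \<in> V \<Longrightarrow> v \<in> V \<Longrightarrow> dist E u v = 0 \<longleftrightarrow> u = v"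
  using relpow_dist[of u v] by auto

lemma dist_triangle:
  assumes "u \<in> V" "v \<in> V" "w \<in> V"
  shows "dist E u w \<le> dist E u v + dist E v w"
  using relpow_dist[OF assms(1,2)] relpow_dist[OF assms(2,3)]
  by (intro dist_le) (auto simp: relpow_add)

lemma dist_edge_le:
  assumes "u \<in> V" "(v, w) \<in> E"
  shows "dist E u w \<le> Suc (dist E u v)"
  using relpow_dist[OF assms(1), of v] assms(2) edge_in_V by (intro dist_le) auto

lemma dist_edge: "(u, v) \<in> E \<Longrightarrow> dist E u v = 1"
  using dist_edge_le[of u u v] dist_eq_0_iff[of u v] edge_in_V[of u v] by force

lemma dist_SucE:
  assumes "u \<in> V" "v \<in> V" "dist E u v = Suc k"
  obtains w where "(w, v) \<in> E" "dist E u w = k"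
proof -
  have "(u, v) \<in> E ^^ Suc k" using relpow_dist assms by metis
  then obtain w where w: "(u, w) \<in> E ^^ k" "(w, v) \<in> E" by auto
  then have "dist E u w \<le> k" "Suc k \<le> Suc (dist E u w)"
    using dist_le dist_edge_le[of u w v] assms by auto
  then show ?thesis using that w by auto
qed

lemma dist_eq_1_iff: "u \<in> V \<Longrightarrow> v \<in> V \<Longrightarrow> dist E u v = 1 \<longleftrightarrow> (u, v) \<in> E"
  using dist_SucE[of u v 0] dist_edge[of u v] dist_eq_0_iff[of u] edge_in_V
  by (metis One_nat_def)

lemma dist_le_subgraph:
  assumes "E' \<subseteq> E" "connected_simple_graph V' E'" "u \<in> V'" "v \<in> V'"
  shows "dist E u v \<le> dist E' u v"
proof -
  have "E' ^^ k \<subseteq> E ^^ k" for k using assms(1) by (induction k) auto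
  then show ?thesis
    using connected_simple_graph.relpow_dist[OF assms(2-4)] dist_le by blast
qed

definition dist_from :: "'a set \<Rightarrow> 'a \<Rightarrow> nat" where
  "dist_from X u = Min ((\<lambda>x. dist E x u) ` X)"

lemma dist_from_singleton [simp]: "dist_from {v} = dist E v"
  by (simp add: dist_from_def fun_eq_iff)

lemma dist_from_pair: "dist_from {x, y} u = min (dist E x u) (dist E y u)"
  by (simp add: dist_from_def)

lemma dist_from_le: "X \<subseteq> V \<Longrightarrow> x \<in> X \<Longrightarrow> dist_from X u \<le> dist E x u"
  unfolding dist_from_def using finite_subset_V by (intro Min_le) auto

lemma dist_from_attained:
  assumes "X \<subseteq> V" "X \<noteq> {}"
  obtains x where "x \<in> X" "dist_from X u = dist E x u"
proof -
  have "dist_from X u \<in> (\<lambda>x. dist E x u) ` X"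
    unfolding dist_from_def using assms finite_subset_V by (intro Min_in) auto
  then show ?thesis using that by auto
qed

lemma dist_from_edge_le:
  assumes "X \<subseteq> V" "X \<noteq> {}" "(u, w) \<in> E"
  shows "dist_from X w \<le> Suc (dist_from X u)"
proof -
  obtain x where x: "x \<in> X" "dist_from X u = dist E x u"
    using dist_from_attained assms by metis
  have "dist_from X w \<le> dist E x w" using assms(1) x(1) by (rule dist_from_le)
  also have "\<dots> \<le> Suc (dist E x u)" using x assms by (intro dist_edge_le) auto
  finally show ?thesis using x by simp
qed

lemma dist_from_eq_0_iff:
  assumes "X \<subseteq> V" "X \<noteq> {}" "u \<in> V"
  shows "dist_from X u = 0 \<longleftrightarrow> u \<in> X"
proof
  assume "dist_from X u = 0"
  then obtain x where "x \<in> X" "dist E x u = 0" using dist_from_attained assms by metis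
  then show "u \<in> X" using dist_eq_0_iff[of x u] assms by auto
next
  assume "u \<in> X"
  then show "dist_from X u = 0" using dist_from_le[OF assms(1), of u u] by simp
qed

lemma dist_from_eq_1_iff:
  assumes "X \<subseteq> V" "X \<noteq> {}" "u \<in> V - X"
  shows "dist_from X u = 1 \<longleftrightarrow> u \<in> E `` X"
proof
  assume "dist_from X u = 1"
  then obtain x where "x \<in> X" "dist E x u = 1" using dist_from_attained assms by metis
  then show "u \<in> E `` X" using dist_eq_1_iff[of x u] assms by auto
next
  assume "u \<in> E `` X"
  then obtain x where "x \<in> X" "(x, u) \<in> E" by auto
  then have "dist_from X u \<le> 1" using dist_from_le[OF assms(1)] dist_edge by metis
  moreover have "dist_from X u \<noteq> 0" using dist_from_eq_0_iff assms by auto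
  ultimately show "dist_from X u = 1" by linarith
qed

definition layer :: "'a \<Rightarrow> nat \<Rightarrow> 'a set" where
  "layer v i = {u\<in>V. dist E v u = i}"

lemma layer_subset_V: "layer v i \<subseteq> V" by (auto simp: layer_def)

lemma finite_layer [simp]: "finite (layer v i)" by (simp add: layer_def)

lemma layer_1: "v \<in> V \<Longrightarrow> layer v 1 = nbrs v"
  using dist_eq_1_iff[of v] edge_in_V by (auto simp: layer_def)

subsection \<open>Vertex cuts\<close>

definition cuts_off :: "'a set \<Rightarrow> 'a set \<Rightarrow> bool" where
  "cuts_off S A \<longleftrightarrow> A \<noteq> {} \<and> A \<subseteq> V \<and> A \<inter> S = {} \<and> E `` A \<subseteq> A \<union> S \<and> \<not> V \<subseteq> A \<union> S"

definition vertex_connected :: "nat \<Rightarrow> bool" where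
  "vertex_connected k \<longleftrightarrow> (\<forall>S A. S \<subseteq> V \<longrightarrow> card S < k \<longrightarrow> \<not> cuts_off S A)"

lemma not_cuts_off_empty: "\<not> cuts_off {} A"
  using closed_eq_V[of A] by (auto simp: cuts_off_def)

lemma cuts_off_opposite: "cuts_off S A \<Longrightarrow> cuts_off S (V - A - S)"
  unfolding cuts_off_def using edge_sym edge_in_V by blast

lemma cuts_off_drop:
  assumes "cuts_off (insert s S) A" "nbrs s \<inter> A = {}"
  shows "cuts_off S A"
  using assms edge_sym unfolding cuts_off_def by blast

lemma vertex_connected_card_V_le:
  assumes "vertex_connected k" "S \<subseteq> V" "card S < k"
    and "A \<noteq> {}" "A \<subseteq> V" "A \<inter> S = {}" "E `` A \<subseteq> A \<union> S"
  shows "card V \<le> card A + card S"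
proof -
  have "V \<subseteq> A \<union> S" using assms unfolding vertex_connected_def cuts_off_def by blast
  then have "card V \<le> card (A \<union> S)" using assms by (intro card_mono) (auto intro: finite_subset_V)
  also have "\<dots> \<le> card A + card S" by (rule card_Un_le)
  finally show ?thesis .
qed

end

section \<open>Sums over layers\<close>

definition layered :: "nat \<Rightarrow> 'a set \<Rightarrow> ('a \<Rightarrow> nat) \<Rightarrow> bool" where
  "layered k A d \<longleftrightarrow> (\<forall>i\<ge>1. (\<exists>u\<in>A. i < d u) \<longrightarrow> k \<le> card {u\<in>A. d u = i})"

text \<open>For \<open>a = q k + r\<close>, placing \<open>k\<close> elements at each of the distances \<open>1, \<dots>, q\<close> and \<open>r\<close> at \<open>q + 1\<close>
gives the sum \<open>(a\<^sup>2 + k a + r (k - r)) / (2 k)\<close>, and \<open>r (k - r) \<le> k\<^sup>2 div 4\<close>.\<close>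

definition layer_bound :: "nat \<Rightarrow> nat \<Rightarrow> real" where
  "layer_bound k a = (real a ^ 2 + real k * real a + real (k ^ 2 div 4)) / (2 * real k)"

lemma layer_bound_2: "layer_bound 2 a = (real a + 1) ^ 2 / 4"
  by (simp add: layer_bound_def power2_eq_square algebra_simps)

lemma layer_bound_3: "layer_bound 3 a = (real a + 1) * (real a + 2) / 6"
  by (simp add: layer_bound_def power2_eq_square algebra_simps)

lemma layer_bound_mono: "a \<le> b \<Longrightarrow> layer_bound k a \<le> layer_bound k b"
  unfolding layer_bound_def by (intro divide_right_mono add_mono power_mono mult_left_mono) auto

lemma le_layer_bound:
  assumes "1 \<le> k"
  shows "real a \<le> layer_bound k a"
proof -
  have "k * a \<le> a ^ 2 + k ^ 2 div 4"
  proof (cases "a \<le> k")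
    case True
    then obtain c where c: "k = a + c" by (auto simp: le_iff_add)
    have "4 * (int a * int c) \<le> (int a + int c) ^ 2"
      using zero_le_power2[of "int a - int c"] by (simp add: power2_eq_square algebra_simps)
    then have "int (a * c * 4) \<le> int (k ^ 2)" by (simp add: c mult_ac)
    then have "a * c * 4 \<le> k ^ 2" by (simp only: of_nat_le_iff)
    then have "a * c \<le> k ^ 2 div 4" by (simp add: less_eq_div_iff_mult_less_eq)
    then show ?thesis by (simp add: c power2_eq_square algebra_simps)
  qed (simp add: power2_eq_square trans_le_add1)
  then have "real (k * a) \<le> real (a ^ 2 + k ^ 2 div 4)" by (simp only: of_nat_le_iff)
  then show ?thesis using assms by (simp add: layer_bound_def field_simps)
qed

lemma add_layer_bound_le:
  assumes "1 \<le> k" "b + k \<le> a"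
  shows "real a + layer_bound k b \<le> layer_bound k a"
proof -
  have "layer_bound k b \<le> layer_bound k (a - k)" using assms by (intro layer_bound_mono) simp
  also have "\<dots> = layer_bound k a - real a"
    using assms by (simp add: layer_bound_def of_nat_diff power2_eq_square field_simps)
  finally show ?thesis by simp
qed

context
  fixes A :: "'a set" and d :: "'a \<Rightarrow> nat"
  assumes finite_A: "finite A" and pos: "\<forall>u\<in>A. 1 \<le> d u"
begin

lemma sum_peel_layer: "sum d A = card A + (\<Sum>u\<in>{u\<in>A. 1 < d u}. d u - 1)"
proof -
  have "sum d A = (\<Sum>u\<in>A. 1 + (d u - 1))" using pos by (intro sum.cong) auto
  also have "\<dots> = card A + (\<Sum>u\<in>A. d u - 1)" by (simp only: sum.distrib) simp
  also have "(\<Sum>u\<in>A. d u - 1) = (\<Sum>u\<in>{u\<in>A. 1 < d u}. d u - 1)"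
    using pos finite_A by (intro sum.mono_neutral_right) auto
  finally show ?thesis .
qed

lemma card_peel_layer: "card {u\<in>A. 1 < d u} + card {u\<in>A. d u = 1} = card A"
proof -
  have "card {u\<in>A. 1 < d u} + card {u\<in>A. d u = 1} = card ({u\<in>A. 1 < d u} \<union> {u\<in>A. d u = 1})"
    using finite_A by (intro card_Un_disjoint[symmetric]) auto
  also have "{u\<in>A. 1 < d u} \<union> {u\<in>A. d u = 1} = A" using pos by force
  finally show ?thesis .
qed

end

lemma layered_peel_layer:
  assumes "layered k A d"
  shows "layered k {u\<in>A. 1 < d u} (\<lambda>u. d u - 1)"
  unfolding layered_def
proof (intro allI impI)
  fix i :: nat
  assume i: "1 \<le> i" "\<exists>u\<in>{u\<in>A. 1 < d u}. i < d u - 1"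
  then have "\<exists>u\<in>A. Suc i < d u" by force
  moreover have "{u \<in> {u\<in>A. 1 < d u}. d u - 1 = i} = {u\<in>A. d u = Suc i}" using i by auto
  ultimately show "k \<le> card {u \<in> {u\<in>A. 1 < d u}. d u - 1 = i}"
    using assms by (simp add: layered_def)
qed

lemma sum_layered_le:
  assumes "1 \<le> k" "finite A" "\<forall>u\<in>A. 1 \<le> d u" "layered k A d"
  shows "real (sum d A) \<le> layer_bound k (card A)"
  using assms
proof (induction "card A" arbitrary: A d rule: less_induct)
  case less
  let ?B = "{u\<in>A. 1 < d u}"
  note sum = sum_peel_layer[OF less.prems(2,3)] and card = card_peel_layer[OF less.prems(2,3)]
  show ?case
  proof (cases "?B = {}")
    case True
    then have "sum d A = card A" using sum by (simp only: True) simp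
    then show ?thesis using le_layer_bound[OF less.prems(1)] by simp
  next
    case False
    then have "k \<le> card {u\<in>A. d u = 1}"
      using less.prems(4) unfolding layered_def by auto
    then have "card ?B + k \<le> card A" using card by linarith
    moreover from this have "real (\<Sum>u\<in>?B. d u - 1) \<le> layer_bound k (card ?B)"
      using less.prems layered_peel_layer by (intro less.hyps) auto
    ultimately show ?thesis using sum add_layer_bound_le[OF less.prems(1)] by fastforce
  qed
qed

lemma sum_layered_le_first:
  assumes "1 \<le> k" "finite A" "\<forall>u\<in>A. 1 \<le> d u" "layered k A d" "j \<le> card {u\<in>A. d u = 1}"
  shows "real (sum d A) \<le> real (card A) + layer_bound k (card A - j)"
proof -
  let ?B = "{u\<in>A. 1 < d u}"
  have "real (\<Sum>u\<in>?B. d u - 1) \<le> layer_bound k (card ?B)"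
    using assms layered_peel_layer by (intro sum_layered_le) auto
  also have "\<dots> \<le> layer_bound k (card A - j)"
    using card_peel_layer[OF assms(2,3)] assms(5) by (intro layer_bound_mono) linarith
  finally show ?thesis using sum_peel_layer[OF assms(2,3)] by simp
qed

lemma sum_layered_le_second:
  assumes "1 \<le> k" "finite A" "\<forall>u\<in>A. 1 \<le> d u" "layered k A d"
    and "i \<le> card {u\<in>A. d u = 1}" "j \<le> card {u\<in>A. d u = 2}"
  shows "real (sum d A) \<le> real (card A) + real (card A - i) + layer_bound k (card A - i - j)"
proof -
  let ?B = "{u\<in>A. 1 < d u}"
  have card: "card ?B \<le> card A - i" using card_peel_layer[OF assms(2,3)] assms(5) by linarith
  have "{u\<in>?B. d u - 1 = 1} = {u\<in>A. d u = 2}" by auto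
  then have "real (\<Sum>u\<in>?B. d u - 1) \<le> real (card ?B) + layer_bound k (card ?B - j)"
    using assms layered_peel_layer by (intro sum_layered_le_first) auto
  also have "\<dots> \<le> real (card A - i) + layer_bound k (card A - i - j)"
    using card by (intro add_mono layer_bound_mono) auto
  finally show ?thesis using sum_peel_layer[OF assms(2,3)] by simp
qed

definition dist_sum :: "('a \<times> 'a) set \<Rightarrow> 'a set \<Rightarrow> 'a set \<Rightarrow> nat" where
  "dist_sum E A B = (\<Sum>u\<in>A. \<Sum>v\<in>B. dist E u v)"

lemma wiener_eq_dist_sum: "2 * wiener V E = real (dist_sum E V V)"
  by (simp add: wiener_def dist_sum_def)

context connected_simple_graph
begin

lemma layered_dist_from:
  assumes "C \<subseteq> V" "X \<subseteq> V" "X \<noteq> {}" "E `` C \<subseteq> C \<union> X"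
    and no_cut: "\<And>S A. A \<subset> C \<Longrightarrow> S \<subseteq> V \<Longrightarrow> card S < k \<Longrightarrow> \<not> cuts_off S A"
  shows "layered k C (dist_from X)"
  unfolding layered_def
proof (intro allI impI, rule ccontr)
  fix i :: nat
  let ?A = "{u\<in>C. i < dist_from X u}" and ?S = "{u\<in>C. dist_from X u = i}"
  assume i: "1 \<le> i" "\<exists>u\<in>C. i < dist_from X u" and few: "\<not> k \<le> card ?S"
  have "E `` ?A \<subseteq> ?A \<union> ?S"
  proof
    fix w assume "w \<in> E `` ?A"
    then obtain u where u: "u \<in> C" "i < dist_from X u" "(u, w) \<in> E" by auto
    then have "i \<le> dist_from X w" using dist_from_edge_le[OF assms(2,3) edge_sym] by fastforce
    moreover from this have "w \<in> C"
      using u assms(4) i(1) dist_from_eq_0_iff[OF assms(2,3)] assms(2) by fastforce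
    ultimately show "w \<in> ?A \<union> ?S" by auto
  qed
  moreover obtain x where x: "x \<in> X" using assms(3) by blast
  moreover have "dist_from X x = 0" using dist_from_le[OF assms(2) x, of x] by simp
  ultimately have cut: "cuts_off ?S ?A"
    using i assms(1,2) unfolding cuts_off_def by auto
  have "?S \<noteq> {}" using cut not_cuts_off_empty by metis
  then have "?A \<subset> C" "?S \<subseteq> V" using assms(1) by auto
  then show False using no_cut cut few by (meson not_le)
qed

lemma layered_dist:
  assumes "vertex_connected k" "v \<in> V"
  shows "layered k (V - {v}) (dist E v)"
proof -
  have "layered k (V - {v}) (dist_from {v})"
    using assms edge_in_V by (intro layered_dist_from) (auto simp: vertex_connected_def)
  then show ?thesis by simp
qed

lemma layer_eq_Diff: "1 \<le> i \<Longrightarrow> {u\<in>V - {v}. dist E v u = i} = layer v i"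
  by (auto simp: layer_def)

lemma card_layer_ge:
  assumes "vertex_connected k" "v \<in> V" "u \<in> V" "1 \<le> i" "i < dist E v u"
  shows "k \<le> card (layer v i)"
proof -
  have "\<exists>u\<in>V - {v}. i < dist E v u" using assms by auto
  then have "k \<le> card {u\<in>V - {v}. dist E v u = i}"
    using layered_dist[OF assms(1,2)] assms(4) unfolding layered_def by blast
  then show ?thesis using layer_eq_Diff[OF assms(4)] by simp
qed

definition status :: "'a \<Rightarrow> nat" where "status v = (\<Sum>u\<in>V. dist E v u)"

lemma wiener_eq_sum_status: "2 * wiener V E = (\<Sum>v\<in>V. real (status v))"
  by (simp add: wiener_def status_def)

lemma status_eq: "v \<in> V \<Longrightarrow> status v = sum (dist E v) (V - {v})"
  unfolding status_def using sum.remove[OF finite_V, of v "dist E v"] by simp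

lemma one_le_dist: "v \<in> V \<Longrightarrow> \<forall>u\<in>V - {v}. 1 \<le> dist E v u"
  using dist_eq_0_iff[of v] by (auto simp: Suc_le_eq)

context
  fixes k v
  assumes k: "1 \<le> k" and connected_k: "vertex_connected k" and v: "v \<in> V"
begin

lemma status_le: "real (status v) \<le> layer_bound k (card V - 1)"
  using sum_layered_le[OF k _ one_le_dist[OF v] layered_dist[OF connected_k v]] v
  by (simp add: status_eq)

lemma status_le_first:
  assumes "i \<le> card (nbrs v)"
  shows "real (status v) \<le> real (card V - 1) + layer_bound k (card V - 1 - i)"
  using sum_layered_le_first[OF k _ one_le_dist[OF v] layered_dist[OF connected_k v], of i] assms
    layer_eq_Diff[of 1 v] layer_1[OF v] v
  by (simp add: status_eq)

lemma status_le_second: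
  assumes "i \<le> card (nbrs v)" "j \<le> card (layer v 2)"
  shows "real (status v)
    \<le> real (card V - 1) + real (card V - 1 - i) + layer_bound k (card V - 1 - i - j)"
  using sum_layered_le_second[OF k _ one_le_dist[OF v] layered_dist[OF connected_k v], of i j] assms
    layer_eq_Diff[of _ v] layer_1[OF v] v
  by (simp add: status_eq)

end

end

section \<open>Linked graphs and 2-vertex separations\<close>

definition bipartite :: "('a \<times> 'a) set \<Rightarrow> bool" where
  "bipartite E \<longleftrightarrow> (\<exists>c :: 'a \<Rightarrow> bool. \<forall>u v. (u, v) \<in> E \<longrightarrow> c u \<noteq> c v)"

definition joined :: "('a \<times> 'a) set \<Rightarrow> 'a \<Rightarrow> 'a \<Rightarrow> 'a \<Rightarrow> bool" where
  "joined E v p q \<longleftrightarrow> (\<exists>w. w \<noteq> v \<and> (p, w) \<in> E \<and> (q, w) \<in> E)"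

text \<open>In other words, the graph of the relation \<^term>\<open>joined E v\<close> on the neighbours of \<open>v\<close> is connected
and has no cut vertex.\<close>

definition linked_at :: "('a \<times> 'a) set \<Rightarrow> 'a \<Rightarrow> bool" where
  "linked_at E v \<longleftrightarrow> (\<forall>X Y. X \<noteq> {} \<and> Y \<noteq> {} \<and> X \<inter> Y = {} \<and> X \<union> Y \<subseteq> E `` {v} \<and>
     card (E `` {v} - (X \<union> Y)) \<le> 1 \<longrightarrow> (\<exists>p\<in>X. \<exists>q\<in>Y. joined E v p q))"

lemma joined_commute: "joined E v p q \<longleftrightarrow> joined E v q p"
  by (auto simp: joined_def)

lemma joinedI: "w \<noteq> v \<Longrightarrow> (p, w) \<in> E \<Longrightarrow> (q, w) \<in> E \<Longrightarrow> joined E v p q"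
  by (auto simp: joined_def)

lemma linked_atI:
  assumes "\<And>X Y. \<lbrakk>X \<noteq> {}; Y \<noteq> {}; X \<inter> Y = {}; X \<union> Y \<subseteq> E `` {v};
      card (E `` {v} - (X \<union> Y)) \<le> 1\<rbrakk> \<Longrightarrow> \<exists>p\<in>X. \<exists>q\<in>Y. joined E v p q"
  shows "linked_at E v"
  using assms by (simp add: linked_at_def)

lemma linked_atE:
  assumes "linked_at E v" "X \<noteq> {}" "Y \<noteq> {}" "X \<inter> Y = {}" "X \<union> Y \<subseteq> E `` {v}"
    "card (E `` {v} - (X \<union> Y)) \<le> 1"
  obtains p q w where "p \<in> X" "q \<in> Y" "w \<noteq> v" "(p, w) \<in> E" "(q, w) \<in> E"
  using assms unfolding linked_at_def joined_def by metis

locale linked_graph = connected_simple_graph +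
  assumes bipartite: "bipartite E"
    and degree_ge_2: "v \<in> V \<Longrightarrow> 2 \<le> card (E `` {v})"
    and linked: "v \<in> V \<Longrightarrow> linked_at E v"
begin

definition colour :: "'a \<Rightarrow> bool" where
  "colour = (SOME c. \<forall>u v. (u, v) \<in> E \<longrightarrow> c u \<noteq> c v)"

lemma colour_edge: "(u, v) \<in> E \<Longrightarrow> colour v \<longleftrightarrow> \<not> colour u"
  using someI_ex[OF bipartite[unfolded bipartite_def]] unfolding colour_def[symmetric] by blast

lemma colour_dist:
  assumes "v \<in> V" "u \<in> V"
  shows "colour u = (colour v = even (dist E v u))"
  using assms(2)
proof (induction "dist E v u" arbitrary: u)
  case 0
  then show ?case using dist_eq_0_iff[of v u] assms(1) by auto
next
  case (Suc k)
  then obtain w where w: "(w, u) \<in> E" "dist E v w = k" using dist_SucE[OF assms(1)] by metis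
  then have "colour w = (colour v = even k)" using Suc.hyps(1)[of w] edge_in_V by auto
  then show ?case using colour_edge[OF w(1)] unfolding Suc.hyps(2)[symmetric] by auto
qed

lemma even_dist_edge:
  assumes "v \<in> V" "(u, w) \<in> E"
  shows "even (dist E v w) \<longleftrightarrow> odd (dist E v u)"
  using colour_dist[OF assms(1), of u] colour_dist[OF assms(1), of w] colour_edge[OF assms(2)]
    edge_in_V[OF assms(2)] by auto

lemma dist_eq_2:
  assumes "(v, u) \<in> E" "(u, w) \<in> E" "w \<noteq> v"
  shows "dist E v w = 2"
proof -
  have V: "v \<in> V" "w \<in> V" using assms edge_in_V by auto
  have "dist E v w \<le> 2" using dist_edge_le[of v u w] dist_edge[OF assms(1)] assms V by simp
  moreover have "dist E v w \<noteq> 0" using V assms by (simp add: dist_eq_0_iff)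
  moreover have "even (dist E v w)"
    using even_dist_edge[OF V(1) assms(2)] dist_edge[OF assms(1)] by simp
  ultimately show ?thesis by presburger
qed

lemma vertex_connected_2: "vertex_connected 2"
  unfolding vertex_connected_def
proof (intro allI impI notI)
  fix S A assume S: "S \<subseteq> V" "card S < 2" and cut: "cuts_off S A"
  have "S \<noteq> {}" using cut not_cuts_off_empty by metis
  moreover have "card S = 0 \<or> card S = 1" using S(2) by linarith
  ultimately obtain s where s: "S = {s}"
    using S(1) finite_subset_V by (auto simp: card_1_singleton_iff)
  define B where "B = V - A - {s}"
  have cuts: "cuts_off {s} A" "cuts_off {s} B"
    using cut cuts_off_opposite by (simp_all add: s B_def)
  have sV: "s \<in> V" using S s by auto
  have nonempty: "nbrs s \<inter> A \<noteq> {}" "nbrs s \<inter> B \<noteq> {}"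
    using cuts cuts_off_drop[of s "{}"] not_cuts_off_empty by blast+
  have "nbrs s - (nbrs s \<inter> A \<union> nbrs s \<inter> B) = {}"
    using edge_in_V by (auto simp: B_def)
  then have "card (nbrs s - (nbrs s \<inter> A \<union> nbrs s \<inter> B)) \<le> 1" by (simp only: card.empty)
  moreover have "nbrs s \<inter> A \<inter> (nbrs s \<inter> B) = {}" by (auto simp: B_def)
  ultimately obtain p q w
    where w: "p \<in> nbrs s \<inter> A" "q \<in> nbrs s \<inter> B" "w \<noteq> s" "(p, w) \<in> E" "(q, w) \<in> E"
    using linked_atE[OF linked[OF sV] nonempty] by (metis Int_lower1 Un_least)
  then have "w \<in> A" "w \<in> B" using cuts unfolding cuts_off_def by blast+
  then show False by (simp add: B_def)
qed

definition fragment :: "'a \<Rightarrow> 'a \<Rightarrow> 'a set \<Rightarrow> bool" where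
  "fragment x y C \<longleftrightarrow> x \<in> V \<and> y \<in> V \<and> x \<noteq> y \<and> cuts_off {x, y} C"

abbreviation opposite :: "'a \<Rightarrow> 'a \<Rightarrow> 'a set \<Rightarrow> 'a set" where
  "opposite x y C \<equiv> V - C - {x, y}"

lemma cuts_off_imp_fragment:
  assumes "S \<subseteq> V" "card S < 3" "cuts_off S A"
  shows "\<exists>x y. fragment x y A"
proof -
  have "\<not> card S < 2" using vertex_connected_2 assms(1,3) by (auto simp: vertex_connected_def)
  then have "card S = 2" using assms(2) by linarith
  then obtain x y where "S = {x, y}" "x \<noteq> y" by (auto simp: card_2_iff)
  then show ?thesis using assms by (auto simp: fragment_def)
qed

lemma minimum_fragment:
  assumes "\<not> vertex_connected 3"
  obtains x y C where "fragment x y C" "\<And>r s A. fragment r s A \<Longrightarrow> card C \<le> card A"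
proof -
  let ?P = "\<lambda>C. \<exists>x y. fragment x y C"
  obtain C where "?P C" using assms cuts_off_imp_fragment unfolding vertex_connected_def by metis
  then have "?P (arg_min card ?P)" by (rule arg_min_natI)
  then obtain x y where "fragment x y (arg_min card ?P)" by blast
  moreover have "card (arg_min card ?P) \<le> card A" if "fragment r s A" for r s A
    using that by (intro arg_min_nat_le) blast
  ultimately show ?thesis by (rule that)
qed

lemma
  assumes "fragment x y C"
  shows fragment_left_in_V: "x \<in> V" and fragment_right_in_V: "y \<in> V"
    and fragment_ends_distinct: "x \<noteq> y" and fragment_subset_V: "C \<subseteq> V"
    and fragment_nonempty: "C \<noteq> {}" and fragment_left_notin: "x \<notin> C"
    and fragment_right_notin: "y \<notin> C" and finite_fragment: "finite C"
    and fragment_boundary: "E `` C \<subseteq> C \<union> {x, y}" and opposite_nonempty: "opposite x y C \<noteq> {}"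
  using assms finite_subset_V unfolding fragment_def cuts_off_def by blast+

lemmas fragmentD = fragment_left_in_V fragment_right_in_V fragment_ends_distinct fragment_subset_V
  fragment_nonempty fragment_left_notin fragment_right_notin finite_fragment fragment_boundary
  opposite_nonempty

lemma fragment_commute: "fragment x y C \<Longrightarrow> fragment y x C"
  by (auto simp: fragment_def insert_commute)

definition minimal_fragment :: "'a \<Rightarrow> 'a \<Rightarrow> 'a set \<Rightarrow> bool" where
  "minimal_fragment x y C \<longleftrightarrow> fragment x y C \<and> (\<forall>r s A. A \<subset> C \<longrightarrow> \<not> fragment r s A)"

lemma minimal_fragment_imp_fragment: "minimal_fragment x y C \<Longrightarrow> fragment x y C"
  by (simp add: minimal_fragment_def)

lemma minimal_fragment_commute: "minimal_fragment x y C \<Longrightarrow> minimal_fragment y x C"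
  using fragment_commute by (simp add: minimal_fragment_def)

lemma fragment_opposite: "fragment x y C \<Longrightarrow> fragment x y (opposite x y C)"
  by (simp add: fragment_def cuts_off_opposite)

lemma opposite_opposite: "fragment x y C \<Longrightarrow> opposite x y (opposite x y C) = C"
  using fragment_subset_V fragment_left_notin fragment_right_notin by blast

lemma fragment_no_edge:
  "fragment x y C \<Longrightarrow> c \<in> C \<Longrightarrow> d \<in> opposite x y C \<Longrightarrow> (c, d) \<notin> E \<and> (d, c) \<notin> E"
  using fragment_boundary edge_sym by blast

lemma nbrs_meet_fragment: "fragment x y C \<Longrightarrow> nbrs x \<inter> C \<noteq> {}"
  using cuts_off_drop[of x "{y}" C] vertex_connected_2
  by (auto simp: fragment_def vertex_connected_def)

lemma fragment_linked:
  assumes frag: "fragment x y C"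
    and X: "X \<subseteq> nbrs x \<inter> C" "X \<noteq> {}" and Y: "Y \<subseteq> nbrs x \<inter> opposite x y C" "Y \<noteq> {}"
    and rest: "card (nbrs x - (X \<union> Y)) \<le> 1"
  obtains p q where "p \<in> X" "q \<in> Y" "(y, p) \<in> E" "(y, q) \<in> E"
proof -
  have "X \<inter> Y = {}" "X \<union> Y \<subseteq> nbrs x" using X Y by auto
  then obtain p q w where w: "p \<in> X" "q \<in> Y" "w \<noteq> x" "(p, w) \<in> E" "(q, w) \<in> E"
    using linked_atE[OF linked[OF fragment_left_in_V[OF frag]] X(2) Y(2) _ _ rest] by metis
  then have "w \<in> V - C - opposite x y C" using X Y edge_in_V fragment_no_edge[OF frag] by blast
  then have "w = y" using w(3) by blast
  then show ?thesis using that w edge_sym by blast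
qed

lemma fragment_common_nbr:
  assumes "fragment x y C"
  obtains p where "p \<in> C" "(x, p) \<in> E" "(y, p) \<in> E"
proof -
  have "nbrs x - (nbrs x \<inter> C \<union> nbrs x \<inter> opposite x y C) \<subseteq> {y}" using edge_in_V by auto
  then have "card (nbrs x - (nbrs x \<inter> C \<union> nbrs x \<inter> opposite x y C)) \<le> card {y}"
    by (intro card_mono) auto
  then have "card (nbrs x - (nbrs x \<inter> C \<union> nbrs x \<inter> opposite x y C)) \<le> 1" by simp
  then show ?thesis
    using fragment_linked[OF assms, of "nbrs x \<inter> C" "nbrs x \<inter> opposite x y C"] that
      nbrs_meet_fragment[OF assms] nbrs_meet_fragment[OF fragment_opposite[OF assms]] by blast
qed

lemma fragment_dist: "fragment x y C \<Longrightarrow> dist E x y = 2"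
  by (metis dist_eq_2 edge_sym fragment_ends_distinct fragment_common_nbr)

lemma fragment_nonadjacent: "fragment x y C \<Longrightarrow> (x, y) \<notin> E"
  using fragment_dist dist_edge by fastforce

lemma fragment_two_common_nbrs:
  assumes frag: "fragment x y C" and card_C: "2 \<le> card C"
  obtains p q where "p \<noteq> q" "{p, q} \<subseteq> C \<inter> nbrs x \<inter> nbrs y"
proof -
  obtain p where p: "p \<in> C" "(x, p) \<in> E" "(y, p) \<in> E" using fragment_common_nbr[OF frag] by metis
  have "\<exists>q. q \<noteq> p \<and> q \<in> C \<inter> nbrs x \<inter> nbrs y"
  proof (rule ccontr)
    assume unique: "\<not> ?thesis"
    have "nbrs x \<inter> C - {p} = {}"
    proof (rule ccontr)
      let ?rest = "nbrs x - ((nbrs x \<inter> C - {p}) \<union> nbrs x \<inter> opposite x y C)"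
      assume nonempty: "nbrs x \<inter> C - {p} \<noteq> {}"
      have "?rest \<subseteq> {p}" using edge_in_V fragment_nonadjacent[OF frag] by auto
      then have "card ?rest \<le> card {p}" by (intro card_mono) auto
      then have "card ?rest \<le> 1" by simp
      then obtain q where "q \<in> nbrs x \<inter> C - {p}" "(y, q) \<in> E"
        by (rule fragment_linked[OF frag _ nonempty _
              nbrs_meet_fragment[OF fragment_opposite[OF frag]], rotated 2]) auto
      then show False using unique by auto
    qed
    then have "E `` (C - {p}) \<subseteq> (C - {p}) \<union> {p, y}"
      using fragment_boundary[OF frag] edge_sym by blast
    moreover have "C - {p} \<noteq> {}" using card_C card_mono[of "{p}" C] by auto
    ultimately have "fragment p y (C - {p})"
      using fragmentD[OF frag] p(1) unfolding fragment_def cuts_off_def by auto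
    then show False using fragment_nonadjacent p(3) edge_sym by blast
  qed
  then show ?thesis using that p by blast
qed

subsection \<open>Deleting a fragment\<close>

lemma nbrs_delete_fragment_end:
  assumes "fragment x y C"
  shows "Restr E (V - C) `` {x} = nbrs x \<inter> opposite x y C" "nbrs x \<subseteq> Restr E (V - C) `` {x} \<union> C"
  using fragmentD[OF assms] fragment_nonadjacent[OF assms] edge_in_V by auto

lemma joined_delete_fragment_end:
  assumes frag: "fragment x y C"
    and X: "X \<noteq> {}" and Y: "Y \<noteq> {}" and disjoint: "X \<inter> Y = {}"
    and sub: "X \<union> Y \<subseteq> Restr E (V - C) `` {x}"
    and rest: "card (Restr E (V - C) `` {x} - (X \<union> Y)) \<le> 1"
    and away: "X \<inter> nbrs y = {}"
  shows "\<exists>p\<in>X. \<exists>q\<in>Y. joined (Restr E (V - C)) x p q"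
proof -
  let ?E = "Restr E (V - C)"
  note nbrs' = nbrs_delete_fragment_end[OF frag]
  let ?Y = "Y \<union> nbrs x \<inter> C"
  have "nbrs x - (X \<union> ?Y) \<subseteq> ?E `` {x} - (X \<union> Y)" using nbrs' by auto
  then have "card (nbrs x - (X \<union> ?Y)) \<le> card (?E `` {x} - (X \<union> Y))"
    by (intro card_mono) (simp_all add: nbrs'(1))
  then have "card (nbrs x - (X \<union> ?Y)) \<le> 1" using rest by linarith
  moreover have "?Y \<noteq> {}" "X \<inter> ?Y = {}" "X \<union> ?Y \<subseteq> nbrs x"
    using Y disjoint sub nbrs'(1) by blast+
  ultimately obtain p q w
    where w: "p \<in> X" "q \<in> ?Y" "w \<noteq> x" "(p, w) \<in> E" "(q, w) \<in> E"
    using linked_atE[OF linked[OF fragment_left_in_V[OF frag]] X] by metis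
  have p: "p \<in> opposite x y C" using w(1) sub nbrs'(1) by blast
  have wV: "w \<in> V - C" using p w(4) edge_in_V fragment_no_edge[OF frag] by blast
  have "w \<noteq> y" using w(1,4) edge_sym away by blast
  then have "q \<notin> C" using w(3,5) wV fragment_no_edge[OF frag] by blast
  then have "q \<in> Y" "q \<in> V - C" using w(2) sub nbrs'(1) by blast+
  then have "(p, w) \<in> ?E" "(q, w) \<in> ?E" using w p wV by blast+
  then have "joined ?E x p q" using w(3) joinedI by metis
  then show ?thesis using w(1) \<open>q \<in> Y\<close> by blast
qed

lemma linked_at_delete_fragment_end:
  assumes frag: "fragment x y C"
  shows "linked_at (Restr E (V - C)) x"
proof (rule linked_atI)
  let ?E = "Restr E (V - C)"
  fix X Y
  assume XY: "X \<noteq> {}" "Y \<noteq> {}" "X \<inter> Y = {}" "X \<union> Y \<subseteq> ?E `` {x}"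
    "card (?E `` {x} - (X \<union> Y)) \<le> 1"
  consider (X_away) "X \<inter> nbrs y = {}" | (Y_away) "Y \<inter> nbrs y = {}"
    | (both) p q where "p \<in> X \<inter> nbrs y" "q \<in> Y \<inter> nbrs y"
    by blast
  then show "\<exists>p\<in>X. \<exists>q\<in>Y. joined ?E x p q"
  proof cases
    case X_away
    with frag XY show ?thesis by (rule joined_delete_fragment_end)
  next
    case Y_away
    have "Y \<inter> X = {}" "Y \<union> X \<subseteq> ?E `` {x}" "card (?E `` {x} - (Y \<union> X)) \<le> 1"
      using XY by (auto simp: Un_commute)
    with XY(2,1) obtain p q where "p \<in> Y" "q \<in> X" "joined ?E x p q"
      using joined_delete_fragment_end[OF frag _ _ _ _ _ Y_away] by metis
    then show ?thesis using joined_commute[of ?E x p q] by blast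
  next
    case both
    then have "(p, y) \<in> ?E" "(q, y) \<in> ?E"
      using XY(4) nbrs_delete_fragment_end(1)[OF frag] fragment_right_in_V[OF frag]
        fragment_right_notin[OF frag] edge_sym by blast+
    then have "joined ?E x p q" using joinedI[of y x] fragment_ends_distinct[OF frag] by metis
    then show ?thesis using both by blast
  qed
qed

lemma simple_graph_Restr: "A \<subseteq> V \<Longrightarrow> simple_graph A (Restr E A)"
  using edge_sym finite_subset_V by (auto simp: simple_graph_def)

lemma nbrs_delete_fragment:
  assumes "fragment x y C" "v \<in> opposite x y C"
  shows "Restr E (V - C) `` {v} = nbrs v"
  using fragment_no_edge[OF assms(1)] assms(2) edge_in_V by blast

context
  fixes x y C
  assumes frag: "fragment x y C" and opposite_ge_2: "2 \<le> card (opposite x y C)"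
begin

lemma two_common_nbrs_delete_fragment:
  obtains p q where "p \<noteq> q" "{p, q} \<subseteq> Restr E (V - C) `` {x}" "{p, q} \<subseteq> Restr E (V - C) `` {y}"
proof -
  obtain p q where "p \<noteq> q" "{p, q} \<subseteq> opposite x y C \<inter> nbrs x \<inter> nbrs y"
    using fragment_two_common_nbrs[OF fragment_opposite[OF frag] opposite_ge_2] .
  then show ?thesis using that[of p q] fragmentD[OF frag] by blast
qed

lemma connected_delete_fragment: "connected_graph (V - C) (Restr E (V - C))"
proof (rule connected_graphI[OF simple_graph_Restr[OF Diff_subset]])
  let ?E = "Restr E (V - C)"
  show "V - C \<noteq> {}" using fragmentD[OF frag] by blast
  have meets: "x \<in> A" if A: "A \<subseteq> V - C" "A \<noteq> {}" "?E `` A \<subseteq> A" for A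
  proof (rule ccontr)
    assume "x \<notin> A"
    obtain p q where "{p, q} \<subseteq> ?E `` {x}" "{p, q} \<subseteq> ?E `` {y}"
      by (rule two_common_nbrs_delete_fragment)
    then have "(p, x) \<in> ?E" "(y, p) \<in> ?E" using edge_sym by auto
    then have "A \<subseteq> opposite x y C" using A \<open>x \<notin> A\<close> by blast
    then have "E `` A \<subseteq> A" using A(3) nbrs_delete_fragment[OF frag] by blast
    then have "A = V" using A by (intro closed_eq_V) auto
    then show False using \<open>x \<notin> A\<close> fragment_left_in_V[OF frag] by simp
  qed
  fix A assume A: "A \<subseteq> V - C" "A \<noteq> {}" "?E `` A \<subseteq> A"
  have "?E `` (V - C - A) \<subseteq> V - C - A" using A(3) edge_sym by blast
  then have "V - C - A = {}" using meets[OF A] meets[of "V - C - A"] by blast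
  then show "A = V - C" using A(1) by blast
qed

lemma degree_delete_fragment:
  assumes "v \<in> V - C"
  shows "2 \<le> card (Restr E (V - C) `` {v})"
proof (cases "v \<in> opposite x y C")
  case True
  then show ?thesis using nbrs_delete_fragment[OF frag] degree_ge_2 by simp
next
  case False
  then have "v = x \<or> v = y" using assms by blast
  moreover obtain p q
    where pq: "p \<noteq> q" "{p, q} \<subseteq> Restr E (V - C) `` {x}" "{p, q} \<subseteq> Restr E (V - C) `` {y}"
    by (rule two_common_nbrs_delete_fragment)
  ultimately have sub: "{p, q} \<subseteq> Restr E (V - C) `` {v}" by blast
  have "finite (Restr E (V - C) `` {v})" by (rule finite_subset[OF _ finite_nbrs]) blast
  then have "card {p, q} \<le> card (Restr E (V - C) `` {v})" using sub by (rule card_mono)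
  then show ?thesis using pq(1) by simp
qed

lemma linked_at_delete_fragment_interior:
  assumes v: "v \<in> opposite x y C"
  shows "linked_at (Restr E (V - C)) v"
proof (rule linked_atI)
  let ?E = "Restr E (V - C)"
  fix X Y
  assume XY: "X \<noteq> {}" "Y \<noteq> {}" "X \<inter> Y = {}" "X \<union> Y \<subseteq> ?E `` {v}"
    "card (?E `` {v} - (X \<union> Y)) \<le> 1"
  have "v \<in> V" using v by blast
  from linked_atE[OF linked[OF this] XY[unfolded nbrs_delete_fragment[OF frag v]]]
  obtain p q w where w: "p \<in> X" "q \<in> Y" "w \<noteq> v" "(p, w) \<in> E" "(q, w) \<in> E" by metis
  have pq: "p \<in> V - C" "q \<in> V - C" using XY(4) w by blast+
  show "\<exists>p\<in>X. \<exists>q\<in>Y. joined ?E v p q"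
  proof (cases "w \<in> C")
    case True
    then have "p \<in> {x, y}" "q \<in> {x, y}"
      using pq edge_sym[OF w(4)] edge_sym[OF w(5)] fragment_boundary[OF frag] by blast+
    moreover obtain a b
      where ab: "a \<noteq> b" "{a, b} \<subseteq> ?E `` {x}" "{a, b} \<subseteq> ?E `` {y}"
      by (rule two_common_nbrs_delete_fragment)
    moreover obtain e where "e \<in> {a, b}" "e \<noteq> v" using ab(1) by blast
    ultimately have "(p, e) \<in> ?E" "(q, e) \<in> ?E" by blast+
    then have "joined ?E v p q" using \<open>e \<noteq> v\<close> joinedI by metis
    then show ?thesis using w(1,2) by blast
  next
    case False
    then have "(p, w) \<in> ?E" "(q, w) \<in> ?E" using w pq edge_in_V by blast+
    then have "joined ?E v p q" using w(3) joinedI by metis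
    then show ?thesis using w(1,2) by blast
  qed
qed

lemma linked_at_delete_fragment:
  assumes "v \<in> V - C"
  shows "linked_at (Restr E (V - C)) v"
proof -
  consider "v = x" | "v = y" | "v \<in> opposite x y C" using assms by blast
  then show ?thesis
    using linked_at_delete_fragment_end[OF frag]
      linked_at_delete_fragment_end[OF fragment_commute[OF frag]]
      linked_at_delete_fragment_interior
    by cases simp_all
qed

lemma linked_graph_delete_fragment: "linked_graph (V - C) (Restr E (V - C))"
proof unfold_locales
  show "bipartite (Restr E (V - C))" using bipartite by (auto simp: bipartite_def)
qed (fact simple_graph_Restr[OF Diff_subset] connected_delete_fragment degree_delete_fragment
    linked_at_delete_fragment)+

end

lemma layered_2_fragment:
  assumes "fragment x y C"
  shows "layered 2 C (dist_from {x, y})"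
  using fragmentD[OF assms] vertex_connected_2
  by (intro layered_dist_from) (auto simp: vertex_connected_def)

lemma layered_3_minimal_fragment:
  assumes minimal: "minimal_fragment x y C"
  shows "layered 3 C (dist_from {x, y})"
proof (rule layered_dist_from)
  fix S A assume "A \<subset> C" "S \<subseteq> V" "card S < 3"
  moreover from this have "\<not> fragment r s A" for r s
    using minimal by (simp add: minimal_fragment_def)
  ultimately show "\<not> cuts_off S A" using cuts_off_imp_fragment[of S A] by metis
qed (use fragmentD[OF minimal_fragment_imp_fragment[OF minimal]] in auto)

lemma one_le_dist_from_fragment:
  assumes "fragment x y C"
  shows "\<forall>u\<in>C. 1 \<le> dist_from {x, y} u"
proof
  fix u assume "u \<in> C"
  then have "dist_from {x, y} u \<noteq> 0"
    using fragmentD[OF assms] by (subst dist_from_eq_0_iff) auto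
  then show "1 \<le> dist_from {x, y} u" by simp
qed

lemma first_layer_fragment:
  assumes "fragment x y C"
  shows "{u\<in>C. dist_from {x, y} u = 1} = C \<inter> (nbrs x \<union> nbrs y)"
proof -
  have "dist_from {x, y} u = 1 \<longleftrightarrow> u \<in> E `` {x, y}" if "u \<in> C" for u
    using fragmentD[OF assms] that by (intro dist_from_eq_1_iff) auto
  then show ?thesis by auto
qed

end

section \<open>3-connected linked graphs\<close>

definition wiener_bound :: "nat \<Rightarrow> real" where
  "wiener_bound n = (if even n then real n ^ 3 / 12 + 7 / 6 * real n - 2
     else real n ^ 3 / 12 + 11 / 12 * real n - 1)"

lemma wiener_bound_ge: "4 \<le> n \<Longrightarrow> real n ^ 3 / 12 + 11 / 12 * real n - 1 \<le> wiener_bound n"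
  by (simp add: wiener_bound_def)

context linked_graph
begin

lemma nbrs_nbrs_subset: "u \<in> nbrs v \<Longrightarrow> nbrs u \<subseteq> insert v (layer v 2)"
  using dist_eq_2 edge_in_V by (fastforce simp: layer_def)

lemma nbrs_Int_layer_2: "nbrs v \<inter> layer v 2 = {}"
  using dist_edge by (fastforce simp: layer_def)

lemma sum_card_nbrs_Int_swap:
  assumes "finite A" "finite B"
  shows "(\<Sum>a\<in>A. card (nbrs a \<inter> B)) = (\<Sum>b\<in>B. card (nbrs b \<inter> A))"
proof -
  have nbrs_Int: "nbrs a \<inter> B = {b\<in>B. (a, b) \<in> E}" for a B by auto
  have "(\<Sum>a\<in>A. card {b\<in>B. (a, b) \<in> E}) = (\<Sum>b\<in>B. card {a\<in>A. (a, b) \<in> E})"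
    using assms by (intro sum_multicount_gen) auto
  also have "\<dots> = (\<Sum>b\<in>B. card {a\<in>A. (b, a) \<in> E})"
    using edge_sym by (intro sum.cong refl arg_cong[of _ _ card]) blast
  finally show ?thesis by (simp add: nbrs_Int)
qed

definition thin :: "'a set" where
  "thin = {v\<in>V. card (nbrs v) \<le> 3 \<and> card (layer v 2) \<le> 3}"

lemma finite_thin [simp]: "finite thin" by (simp add: thin_def)

context
  assumes connected_3: "vertex_connected 3" and large: "10 \<le> card V"
begin

lemma degree_ge_3:
  assumes "v \<in> V"
  shows "3 \<le> card (nbrs v)"
proof (rule ccontr)
  assume "\<not> 3 \<le> card (nbrs v)"
  moreover from this have "card V \<le> card {v} + card (nbrs v)"
    using assms nbrs_subset_V by (intro vertex_connected_card_V_le[OF connected_3]) auto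
  ultimately show False using large by simp
qed

lemma card_nbrs_thin: "v \<in> thin \<Longrightarrow> card (nbrs v) = 3"
  using degree_ge_3[of v] by (simp add: thin_def)

lemma card_layer_2_thin:
  assumes v: "v \<in> thin"
  shows "card (layer v 2) = 3"
proof (rule ccontr)
  assume "card (layer v 2) \<noteq> 3"
  then have few: "card (layer v 2) \<le> 2" using v by (simp add: thin_def)
  have "insert v (nbrs v) \<inter> layer v 2 = {}" using nbrs_Int_layer_2[of v] by (auto simp: layer_def)
  moreover have "E `` insert v (nbrs v) \<subseteq> insert v (nbrs v) \<union> layer v 2"
    using nbrs_nbrs_subset by blast
  ultimately have "card V \<le> card (insert v (nbrs v)) + card (layer v 2)"
    using few v nbrs_subset_V layer_subset_V
    by (intro vertex_connected_card_V_le[OF connected_3]) (auto simp: thin_def)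
  then show False using few large card_nbrs_thin[OF v] by (simp add: card_insert_if)
qed

lemma card_layer_2_minus_nbrs_le:
  assumes v: "v \<in> thin" and va: "(v, a) \<in> E" and "card (nbrs a) = 3"
  shows "card (layer v 2 - nbrs a) \<le> 1"
proof -
  have "nbrs a - {v} \<subseteq> layer v 2 \<inter> nbrs a" using nbrs_nbrs_subset[of a v] va by blast
  then have "card (nbrs a - {v}) \<le> card (layer v 2 \<inter> nbrs a)" by (intro card_mono) auto
  moreover have "card (nbrs a - {v}) = 2" using assms edge_sym by (subst card_Diff_singleton) auto
  moreover have "card (layer v 2) = card (layer v 2 \<inter> nbrs a) + card (layer v 2 - nbrs a)"
    by (rule card_Int_Diff) simp
  ultimately show ?thesis using card_layer_2_thin[OF v] by linarith
qed

text \<open>Two adjacent thin vertices \<open>v\<close> and \<open>a\<close> would make \<open>nbrs v \<union> nbrs a\<close> a set with only two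
boundary vertices.\<close>

lemma thin_independent:
  assumes v: "v \<in> thin" and va: "(v, a) \<in> E"
  shows "a \<notin> thin"
proof
  assume a: "a \<in> thin"
  let ?A = "nbrs v \<union> nbrs a" and ?S = "(layer v 2 - nbrs a) \<union> (layer a 2 - nbrs v)"
  have av: "(a, v) \<in> E" using va by (rule edge_sym)
  have S: "card ?S \<le> 2"
    using card_Un_le[of "layer v 2 - nbrs a" "layer a 2 - nbrs v"]
      card_layer_2_minus_nbrs_le[OF v va card_nbrs_thin[OF a]]
      card_layer_2_minus_nbrs_le[OF a av card_nbrs_thin[OF v]] by linarith
  have "card V \<le> card ?A + card ?S"
  proof (rule vertex_connected_card_V_le[OF connected_3])
    show "?A \<noteq> {}" using va by blast
    show "?A \<inter> ?S = {}" using nbrs_Int_layer_2 by blast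
    show "E `` ?A \<subseteq> ?A \<union> ?S" using nbrs_nbrs_subset va av by blast
    show "?A \<subseteq> V" "?S \<subseteq> V" using nbrs_subset_V layer_subset_V by blast+
    show "card ?S < 3" using S by simp
  qed
  also have "\<dots> \<le> 8"
    using S card_Un_le[of "nbrs v" "nbrs a"] card_nbrs_thin[OF v] card_nbrs_thin[OF a] by linarith
  finally show False using large by simp
qed

text \<open>Otherwise \<open>nbrs a\<close> is one side of the bipartition, and counting edges gives \<open>3 \<bar>R\<bar> \<le> 12\<close>
for the other side \<open>R\<close>.\<close>

lemma not_all_nbrs_thin:
  assumes four: "card (nbrs a) = 4"
  shows "\<not> nbrs a \<subseteq> thin"
proof
  assume thin: "nbrs a \<subseteq> thin"
  define R where "R = E `` nbrs a"
  have R: "R \<subseteq> V" "finite R" using edge_in_V finite_subset_V[of R] by (auto simp: R_def)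
  have layer_2: "layer u 2 \<subseteq> nbrs a" if u: "u \<in> nbrs a" for u
  proof -
    have "nbrs a - {u} \<subseteq> layer u 2" using nbrs_nbrs_subset[of a u] u edge_sym by blast
    then have "nbrs a - {u} = layer u 2"
      using four u thin card_layer_2_thin[of u] by (intro card_seteq) auto
    then show ?thesis by blast
  qed
  have nbrs_R: "nbrs r \<subseteq> nbrs a" if "r \<in> R" for r
    using that nbrs_nbrs_subset[of r] layer_2 unfolding R_def by blast
  have "nbrs a \<noteq> {}" using four by auto
  then have "nbrs a \<union> R = V"
    using nbrs_R nbrs_subset_V R by (intro closed_eq_V) (auto simp: R_def)
  then have "card V \<le> 4 + card R" using card_Un_le[of "nbrs a" R] four by simp
  moreover have "3 * card R \<le> 12"
  proof -
    have "(\<Sum>r\<in>R. 3) \<le> (\<Sum>r\<in>R. card (nbrs r \<inter> nbrs a))"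
      using nbrs_R degree_ge_3 R by (intro sum_mono) (auto simp: Int_absorb2)
    also have "\<dots> = (\<Sum>u\<in>nbrs a. card (nbrs u \<inter> R))" using R by (intro sum_card_nbrs_Int_swap) auto
    also have "\<dots> \<le> (\<Sum>u\<in>nbrs a. card (nbrs u))" by (intro sum_mono card_mono) auto
    also have "\<dots> = (\<Sum>u\<in>nbrs a. 3)" using thin card_nbrs_thin by (intro sum.cong) auto
    finally show ?thesis using four by (simp add: mult.commute)
  qed
  ultimately show False using large by simp
qed

lemma card_thin_nbrs_le: "card (nbrs a \<inter> thin) \<le> 3"
proof (rule ccontr)
  assume many: "\<not> card (nbrs a \<inter> thin) \<le> 3"
  then obtain v where v: "v \<in> nbrs a" "v \<in> thin" by (metis Int_iff card.empty equals0I zero_le)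
  have "card (nbrs a) \<le> card (insert v (layer v 2))"
    using nbrs_nbrs_subset[of a v] v edge_sym by (intro card_mono) auto
  also have "\<dots> \<le> 4" using card_layer_2_thin[OF v(2)] by (simp add: card_insert_if)
  finally have le: "card (nbrs a) \<le> 4" .
  then have "nbrs a \<inter> thin = nbrs a" using many by (intro card_seteq) auto
  then show False using not_all_nbrs_thin[of a] many le by fastforce
qed

lemma card_thin_le: "2 * card thin \<le> card V"
proof -
  have thin: "thin \<subseteq> V" by (auto simp: thin_def)
  have "card (nbrs v \<inter> (V - thin)) = 3" if "v \<in> thin" for v
  proof -
    have "nbrs v \<inter> (V - thin) = nbrs v" using thin_independent that nbrs_subset_V by blast
    then show ?thesis using card_nbrs_thin[OF that] by simp
  qed
  then have "3 * card thin = (\<Sum>v\<in>thin. card (nbrs v \<inter> (V - thin)))" by simp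
  also have "\<dots> = (\<Sum>b\<in>V - thin. card (nbrs b \<inter> thin))" by (intro sum_card_nbrs_Int_swap) auto
  also have "\<dots> \<le> (\<Sum>b\<in>V - thin. 3)" by (intro sum_mono card_thin_nbrs_le)
  also have "\<dots> = 3 * (card V - card thin)" using thin by (simp add: card_Diff_subset)
  finally show ?thesis by linarith
qed

lemma status_le_not_thin:
  assumes v: "v \<in> V - thin"
  shows "real (status v) \<le> (real (card V) ^ 2 - real (card V) + 12) / 6"
proof -
  have "v \<in> V" using v by simp
  note first = status_le_first[OF _ connected_3 this, of 4]
    and second = status_le_second[OF _ connected_3 this, of 3 4]
  have "4 \<le> card (nbrs v) \<or> 3 \<le> card (nbrs v) \<and> 4 \<le> card (layer v 2)"
    using v degree_ge_3[of v] by (auto simp: thin_def)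
  then have "real (status v) \<le> real (card V - 1) + layer_bound 3 (card V - 5) \<or>
      real (status v) \<le> real (card V - 1) + real (card V - 4) + layer_bound 3 (card V - 8)"
    using first second by auto
  then show ?thesis
    using large by (auto simp: layer_bound_3 of_nat_diff power2_eq_square field_simps)
qed

end

lemma status_le_3_connected:
  assumes "vertex_connected 3" "v \<in> V"
  shows "real (status v) \<le> real (card V) * (real (card V) + 1) / 6"
  using status_le[OF _ assms] card_V_pos[OF assms(2)]
  by (simp add: layer_bound_3 of_nat_diff algebra_simps)

lemma wiener_le_3_connected_small:
  assumes "vertex_connected 3" "4 \<le> card V" "card V \<le> 9"
  shows "wiener V E \<le> wiener_bound (card V)"
proof -
  let ?n = "real (card V)"
  have "2 * wiener V E \<le> (\<Sum>v\<in>V. ?n * (?n + 1) / 6)"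
    unfolding wiener_eq_sum_status by (intro sum_mono status_le_3_connected assms(1))
  also have "\<dots> = ?n ^ 3 / 6 + 11 / 6 * ?n - 2 - ((9 - ?n) * (?n - 2) + 6) / 6"
    by (simp add: power3_eq_cube field_simps)
  also have "\<dots> \<le> ?n ^ 3 / 6 + 11 / 6 * ?n - 2"
    using mult_nonneg_nonneg[of "9 - ?n" "?n - 2"] assms by simp
  finally show ?thesis using wiener_bound_ge[OF assms(2)] by simp
qed

lemma wiener_le_3_connected_large:
  assumes connected_3: "vertex_connected 3" and large: "10 \<le> card V"
  shows "wiener V E \<le> wiener_bound (card V)"
proof -
  let ?n = "real (card V)"
  let ?s = "(?n ^ 2 - ?n + 12) / 6"
  have "real (status v) \<le> ?s + (?n - 6) / 3 * of_bool (v \<in> thin)" if "v \<in> V" for v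
    using status_le_3_connected[OF connected_3 that] status_le_not_thin[OF assms, of v] that
    by (cases "v \<in> thin") (simp_all add: power2_eq_square field_simps)
  then have "2 * wiener V E \<le> (\<Sum>v\<in>V. ?s + (?n - 6) / 3 * of_bool (v \<in> thin))"
    unfolding wiener_eq_sum_status by (rule sum_mono)
  also have "\<dots> = ?n * ?s + (?n - 6) / 3 * real (card thin)"
  proof -
    have "V \<inter> thin = thin" by (auto simp: thin_def)
    then have "(\<Sum>v\<in>V. of_bool (v \<in> thin)) = real (card thin)" by (simp add: Int_def)
    then show ?thesis by (simp only: sum.distrib sum_distrib_left[symmetric] sum_constant)
  qed
  also have "\<dots> \<le> ?n * ?s + (?n - 6) / 3 * (?n / 2)"
    using card_thin_le[OF assms] large by (intro add_left_mono mult_left_mono) auto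
  also have "\<dots> = ?n ^ 3 / 6 + ?n" by (simp add: power2_eq_square power3_eq_cube field_simps)
  finally show ?thesis using wiener_bound_ge[of "card V"] large by simp
qed

lemma wiener_le_3_connected:
  assumes "vertex_connected 3" "4 \<le> card V"
  shows "wiener V E \<le> wiener_bound (card V)"
  using wiener_le_3_connected_small[OF assms] wiener_le_3_connected_large[OF assms(1)] by linarith

end

section \<open>Cutting along a 2-vertex separation\<close>

text \<open>This is \<^term>\<open>wiener_bound (a + b + 2) - wiener_bound (a + 2) - wiener_bound (b + 2) + 2\<close> for
odd \<open>a\<close> and even \<open>b\<close>, the worst parities when \<open>a \<le> b\<close>.\<close>

definition cross_bound :: "real \<Rightarrow> real \<Rightarrow> real" where
  "cross_bound a b = a * b * (a + b) / 4 + a * b + 1 - b / 4"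

lemma cross_bound_le_wiener_bound:
  fixes a b :: nat
  assumes "2 \<le> a" "a \<le> b \<or> odd a \<and> even b"
  shows "wiener_bound (a + 2) + wiener_bound (b + 2) + cross_bound (real a) (real b)
    \<le> wiener_bound (a + b + 2) + 2"
proof -
  have "real (a + b + 2) ^ 3 - real (a + 2) ^ 3 - real (b + 2) ^ 3
      = 3 * real a * real b * (real a + real b) + 12 * real a * real b - 8"
    by (simp add: power3_eq_cube algebra_simps)
  then show ?thesis using assms
    by (cases "even a"; cases "even b") (auto simp: wiener_bound_def cross_bound_def field_simps)
qed

lemma cross_bound_ge_pair_layers:
  assumes "1 \<le> a" "2 \<le> b"
  shows "b * ((a + 1) ^ 2 / 4) + a * (b ^ 2 / 4 + 1) \<le> cross_bound a b"
proof -
  have "b * ((a + 1) ^ 2 / 4) + a * (b ^ 2 / 4 + 1) = cross_bound a b - (a - 1) * (b - 2) / 2"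
    by (simp add: cross_bound_def power2_eq_square field_simps)
  then show ?thesis using mult_nonneg_nonneg[of "a - 1" "b - 2"] assms by simp
qed

lemma cross_bound_ge_triple_layers:
  assumes "3 \<le> a" "a \<le> b"
  shows "b * ((a + 1) * (a + 2) / 6) + a * ((b + 1) ^ 2 / 4) \<le> cross_bound a b"
proof -
  have "b * ((a + 1) * (a + 2) / 6) + a * ((b + 1) ^ 2 / 4)
      = cross_bound a b - (b * (a ^ 2 - 7) / 12 - a / 4 + 1)"
    by (simp add: cross_bound_def power2_eq_square field_simps)
  moreover have "3 * a \<le> a ^ 2" using assms by (simp add: power2_eq_square mult_right_mono)
  then have "3 * (3 * a - 7) \<le> b * (a ^ 2 - 7)" using assms by (intro mult_mono) auto
  ultimately show ?thesis using assms by argo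
qed

lemma cross_bound_ge_triple_layers_wide:
  assumes "4 \<le> a" "a \<le> b"
  shows "b * ((a + 1) * (a + 2) / 6) + a * (b ^ 2 / 4 + 1) + 2 * ((a - 4) * (b - 2))
    \<le> cross_bound a b"
proof -
  have "b * ((a + 1) * (a + 2) / 6) + a * (b ^ 2 / 4 + 1) + 2 * ((a - 4) * (b - 2))
      = cross_bound a b - (b * ((a - 9) ^ 2 + 8) / 12 + 3 * a - 15)"
    by (simp add: cross_bound_def power2_eq_square field_simps)
  moreover have "15 \<le> b * ((a - 9) ^ 2 + 8) / 12 + 3 * a"
  proof (cases "a \<le> 5")
    case True
    have "4 ^ 2 \<le> (9 - a) ^ 2" using True by (intro power_mono) auto
    then have "16 \<le> (a - 9) ^ 2" by (simp add: power2_commute)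
    then have "4 * 24 \<le> b * ((a - 9) ^ 2 + 8)" using assms by (intro mult_mono) auto
    then show ?thesis using assms by simp
  next
    case False
    have "0 \<le> b * ((a - 9) ^ 2 + 8)" using assms by simp
    then show ?thesis using False by simp
  qed
  ultimately show ?thesis by simp
qed

context connected_simple_graph
begin

lemma dist_sum_commute: "dist_sum E A B = dist_sum E B A"
  unfolding dist_sum_def by (subst sum.swap) (simp add: dist_commute)

lemma dist_sum_Un:
  assumes "finite A" "finite B" "A \<inter> B = {}"
  shows "dist_sum E (A \<union> B) (A \<union> B) = dist_sum E A A + 2 * dist_sum E A B + dist_sum E B B"
proof -
  have "dist_sum E (A \<union> B) (A \<union> B)
      = dist_sum E A A + dist_sum E A B + (dist_sum E B A + dist_sum E B B)"
    using assms by (simp add: dist_sum_def sum.union_disjoint sum.distrib)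
  then show ?thesis using dist_sum_commute[of B A] by simp
qed

lemma dist_sum_Un_Un:
  assumes "finite A" "finite S" "finite B" "A \<inter> S = {}" "S \<inter> B = {}" "A \<inter> B = {}"
  shows "dist_sum E (A \<union> S \<union> B) (A \<union> S \<union> B) + dist_sum E S S
    = dist_sum E (A \<union> S) (A \<union> S) + dist_sum E (S \<union> B) (S \<union> B) + 2 * dist_sum E A B"
proof -
  have "dist_sum E (A \<union> S) B = dist_sum E A B + dist_sum E S B"
    using assms by (simp add: dist_sum_def sum.union_disjoint)
  moreover have "(A \<union> S) \<inter> B = {}" using assms by auto
  ultimately show ?thesis
    using dist_sum_Un[of "A \<union> S" B] dist_sum_Un[of S B] assms by simp
qed

definition nearer :: "'a \<Rightarrow> 'a \<Rightarrow> 'a set \<Rightarrow> 'a set" where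
  "nearer x y A = {u\<in>A. dist E x u < dist E y u}"

definition crossing :: "'a \<Rightarrow> 'a \<Rightarrow> 'a set \<Rightarrow> 'a set \<Rightarrow> nat" where
  "crossing x y A B
    = card (nearer x y A) * card (nearer y x B) + card (nearer y x A) * card (nearer x y B)"

lemma nearer_subset: "nearer x y A \<subseteq> A" by (auto simp: nearer_def)

lemma dist_le_dist_from_pair:
  assumes "x \<in> V" "y \<in> V" "dist E x y \<le> 2" and "u \<in> V" "v \<in> V"
  shows "dist E u v \<le> dist_from {x, y} u + dist_from {x, y} v
    + 2 * (of_bool (dist E x u < dist E y u \<and> dist E y v < dist E x v)
      + of_bool (dist E y u < dist E x u \<and> dist E x v < dist E y v))"
proof -
  have "dist E u v \<le> dist E x u + dist E x v" "dist E u v \<le> dist E y u + dist E y v"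
    using dist_triangle[of u x v] dist_triangle[of u y v] assms dist_commute[of u] by auto
  moreover have "dist E y u \<le> dist E x u + 2" "dist E x u \<le> dist E y u + 2"
    using dist_triangle[of y x u] dist_triangle[of x y u] assms dist_commute[of x y] by auto
  ultimately show ?thesis by (auto simp: dist_from_pair min_def)
qed

lemma dist_sum_le_dist_from_pair:
  assumes "x \<in> V" "y \<in> V" "dist E x y \<le> 2" and "A \<subseteq> V" "B \<subseteq> V"
  shows "dist_sum E A B
    \<le> card B * sum (dist_from {x, y}) A + card A * sum (dist_from {x, y}) B + 2 * crossing x y A B"
proof -
  have fin: "finite A" "finite B" using assms finite_subset_V by auto
  have card_product: "(\<Sum>u\<in>A. \<Sum>v\<in>B. of_bool (P u \<and> Q v)) = card {u\<in>A. P u} * card {v\<in>B. Q v}"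
    for P Q
    by (simp only: of_bool_conj sum_product[symmetric]) (use fin in \<open>simp add: Int_def\<close>)
  have "dist_sum E A B \<le> (\<Sum>u\<in>A. \<Sum>v\<in>B. dist_from {x, y} u + dist_from {x, y} v
      + 2 * (of_bool (dist E x u < dist E y u \<and> dist E y v < dist E x v)
        + of_bool (dist E y u < dist E x u \<and> dist E x v < dist E y v)))"
    unfolding dist_sum_def using assms by (intro sum_mono dist_le_dist_from_pair) auto
  also have "\<dots> = card B * sum (dist_from {x, y}) A + card A * sum (dist_from {x, y}) B
    + 2 * crossing x y A B"
    by (simp only: sum.distrib sum_distrib_left[symmetric] sum_constant card_product
        nearer_def crossing_def)
      (simp add: sum_distrib_left)
  finally show ?thesis .
qed

end

context linked_graph
begin

lemma card_V_fragment:
  assumes "fragment x y C"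
  shows "card V = card C + card (opposite x y C) + 2"
proof -
  note C = fragmentD[OF assms]
  have "card (C \<union> {x, y}) = card C + 2" using C by (subst card_Un_disjoint) auto
  moreover have "opposite x y C = V - (C \<union> {x, y})" by blast
  moreover have "card (V - (C \<union> {x, y})) = card V - card (C \<union> {x, y})"
    "card (C \<union> {x, y}) \<le> card V"
    using C by (intro card_Diff_subset card_mono; simp)+
  ultimately show ?thesis by simp
qed

lemma sum_dist_from_fragment_le:
  assumes frag: "fragment x y C"
  shows "real (sum (dist_from {x, y}) C) \<le> (real (card C) + 1) ^ 2 / 4"
  using sum_layered_le[OF _ finite_fragment[OF frag] one_le_dist_from_fragment[OF frag]
      layered_2_fragment[OF frag]]
  by (simp add: layer_bound_2)

lemma sum_dist_from_wide_fragment_le: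
  assumes frag: "fragment x y C" and wide: "3 \<le> card {u\<in>C. dist_from {x, y} u = 1}"
  shows "real (sum (dist_from {x, y}) C) \<le> real (card C) ^ 2 / 4 + 1"
proof -
  have "3 \<le> card C"
    using wide card_mono[of C "{u\<in>C. dist_from {x, y} u = 1}"] finite_fragment[OF frag] by auto
  moreover have "real (sum (dist_from {x, y}) C) \<le> real (card C) + layer_bound 2 (card C - 3)"
    using wide layered_2_fragment[OF frag] one_le_dist_from_fragment[OF frag]
      finite_fragment[OF frag]
    by (intro sum_layered_le_first) auto
  ultimately show ?thesis
    by (simp add: layer_bound_2 of_nat_diff power2_eq_square field_simps)
qed

lemma sum_dist_from_minimal_fragment_le:
  assumes minimal: "minimal_fragment x y C"
  shows "real (sum (dist_from {x, y}) C) \<le> (real (card C) + 1) * (real (card C) + 2) / 6"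
proof -
  have frag: "fragment x y C" using minimal by (rule minimal_fragment_imp_fragment)
  show ?thesis
    using sum_layered_le[OF _ finite_fragment[OF frag] one_le_dist_from_fragment[OF frag]
        layered_3_minimal_fragment[OF minimal]]
    by (simp add: layer_bound_3)
qed

lemma nearer_eq_empty:
  assumes frag: "fragment x y C" and common: "nbrs x \<inter> C \<subseteq> nbrs y"
  shows "nearer x y C = {}"
proof -
  note C = fragmentD[OF frag]
  have "dist E y u \<le> k" if "u \<in> C" "dist E x u = k" for u k
    using that
  proof (induction k arbitrary: u)
    case 0
    then show ?case using C dist_eq_0_iff[of x u] by auto
  next
    case (Suc k)
    have "u \<in> V" using Suc.prems(1) fragment_subset_V[OF frag] by blast
    then obtain w where w: "(w, u) \<in> E" "dist E x w = k"
      using dist_SucE[OF fragment_left_in_V[OF frag]] Suc.prems(2) by metis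
    consider (inside) "w \<in> C" | (terminal) "w = x \<or> w = y"
      using fragment_boundary[OF frag] Suc.prems(1) edge_sym[OF w(1)] by blast
    then show ?case
    proof cases
      case inside
      then show ?thesis
        using Suc.IH[OF inside w(2)] dist_edge_le[OF fragment_right_in_V[OF frag] w(1)] by simp
    next
      case terminal
      then have "(y, u) \<in> E" using w(1) Suc.prems(1) common by auto
      then show ?thesis using dist_edge by simp
    qed
  qed
  then show ?thesis by (force simp: nearer_def)
qed

lemma nearer_narrow_fragment:
  assumes frag: "fragment x y C" and "2 \<le> card C"
    and narrow: "card {u\<in>C. dist_from {x, y} u = 1} \<le> 2"
  shows "nearer x y C = {}" "nearer y x C = {}"
proof -
  obtain p q where pq: "p \<noteq> q" "{p, q} \<subseteq> C \<inter> nbrs x \<inter> nbrs y"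
    using fragment_two_common_nbrs[OF assms(1,2)] .
  then have "{p, q} = C \<inter> (nbrs x \<union> nbrs y)"
    using narrow finite_fragment[OF frag] unfolding first_layer_fragment[OF frag]
    by (intro card_seteq) auto
  then have "nbrs x \<inter> C \<subseteq> nbrs y" "nbrs y \<inter> C \<subseteq> nbrs x" using pq(2) by blast+
  then show "nearer x y C = {}" "nearer y x C = {}"
    using frag fragment_commute by (auto intro!: nearer_eq_empty)
qed

lemma card_nearer_add_le:
  assumes frag: "fragment x y C" and "2 \<le> card C"
  shows "card (nearer x y C) + card (nearer y x C) + 2 \<le> card C"
proof -
  obtain p q where pq: "p \<noteq> q" "{p, q} \<subseteq> C \<inter> nbrs x \<inter> nbrs y"
    using fragment_two_common_nbrs[OF assms] .
  then have "dist E x p = dist E y p" "dist E x q = dist E y q" using dist_edge by auto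
  then have sub: "nearer x y C \<union> nearer y x C \<subseteq> C - {p, q}" by (auto simp: nearer_def)
  have fin: "finite C" using frag by (rule finite_fragment)
  have "card (nearer x y C) + card (nearer y x C) = card (nearer x y C \<union> nearer y x C)"
    using fin by (intro card_Un_disjoint[symmetric]) (auto simp: nearer_def)
  also have "\<dots> \<le> card (C - {p, q})" using sub fin by (intro card_mono) auto
  also have "\<dots> = card C - 2" using pq by (subst card_Diff_subset) auto
  finally show ?thesis using assms(2) by simp
qed

lemma common_nbr_fragment_nbr:
  assumes frag: "fragment x y C" and r: "r \<in> C \<inter> nbrs x \<inter> nbrs y" and w: "w \<in> nbrs r - {x, y}"
  shows "w \<in> C" "dist E x w = 2" "dist E y w = 2"
proof -
  have "(x, r) \<in> E" "(y, r) \<in> E" "(r, w) \<in> E" "w \<noteq> x" "w \<noteq> y" using r w by auto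
  then show "dist E x w = 2" "dist E y w = 2" by (auto intro: dist_eq_2)
  show "w \<in> C" using r w fragment_boundary[OF frag] by blast
qed

lemma fragment_equidistant_vertices:
  assumes frag: "fragment x y C" and "2 \<le> card C" and degree: "\<forall>v\<in>V. 3 \<le> card (nbrs v)"
  obtains p q w where "{p, q} \<subseteq> C \<inter> nbrs x \<inter> nbrs y" "w \<in> C" "dist E x w = 2" "dist E y w = 2"
    "card {p, q, w} = 3"
proof -
  obtain p q where pq: "p \<noteq> q" "{p, q} \<subseteq> C \<inter> nbrs x \<inter> nbrs y"
    using fragment_two_common_nbrs[OF assms(1,2)] .
  have "\<not> nbrs p \<subseteq> {x, y}"
  proof
    assume "nbrs p \<subseteq> {x, y}"
    then have "card (nbrs p) \<le> card {x, y}" by (intro card_mono) auto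
    moreover have "3 \<le> card (nbrs p)" using degree pq fragment_subset_V[OF frag] by auto
    ultimately show False using fragment_ends_distinct[OF frag] by simp
  qed
  then obtain w where "w \<in> nbrs p - {x, y}" by blast
  moreover have "p \<in> C \<inter> nbrs x \<inter> nbrs y" using pq(2) by blast
  ultimately have w: "w \<in> C" "dist E x w = 2" "dist E y w = 2"
    using common_nbr_fragment_nbr[OF frag] by metis+
  moreover have "w \<noteq> p" "w \<noteq> q" using w(2) pq(2) dist_edge[of x] by auto
  ultimately show ?thesis using that[OF pq(2)] pq(1) by simp
qed

lemma card_fragment_ge_3:
  assumes "fragment x y C" "2 \<le> card C" "\<forall>v\<in>V. 3 \<le> card (nbrs v)"
  shows "3 \<le> card C"
proof -
  obtain p q w where w: "{p, q} \<subseteq> C \<inter> nbrs x \<inter> nbrs y" "w \<in> C"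
    "dist E x w = 2" "dist E y w = 2" "card {p, q, w} = 3"
    by (rule fragment_equidistant_vertices[OF assms])
  then have "card {p, q, w} \<le> card C" using finite_fragment[OF assms(1)] by (intro card_mono) auto
  then show ?thesis using w(5) by simp
qed

text \<open>If at most three vertices of \<open>C\<close> were not strictly nearer to \<open>x\<close>, those nearer to \<open>x\<close> would be
cut off by \<open>x\<close> and a single further vertex, contradicting the minimality of \<open>C\<close>.\<close>

lemma card_nearer_minimal_fragment:
  assumes minimal: "minimal_fragment x y C" and card_C: "2 \<le> card C"
    and degree: "\<forall>v\<in>V. 3 \<le> card (nbrs v)"
  shows "nearer x y C = {} \<or> card (nearer x y C) + 4 \<le> card C"
proof (rule ccontr)
  let ?U = "nearer x y C"
  assume few: "\<not> ?thesis"
  have frag: "fragment x y C" using minimal by (rule minimal_fragment_imp_fragment)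
  note C = fragmentD[OF frag]
  obtain p q w where pq: "{p, q} \<subseteq> C \<inter> nbrs x \<inter> nbrs y"
    and w: "w \<in> C" "dist E x w = 2" "dist E y w = 2" and three: "card {p, q, w} = 3"
    by (rule fragment_equidistant_vertices[OF frag card_C degree])
  have "dist E x r = 1 \<and> dist E y r = 1" if "r \<in> {p, q}" for r using that pq dist_edge by auto
  then have sub: "{p, q, w} \<subseteq> C - ?U" using pq w by (auto simp: nearer_def)
  have "card C = card ?U + card (C - ?U)"
    using card_Int_Diff[OF finite_fragment[OF frag], of ?U] nearer_subset[of x y C]
    by (simp add: Int_absorb1)
  then have rest: "{p, q, w} = C - ?U"
    using few three finite_fragment[OF frag] sub by (intro card_seteq) auto
  have "E `` ?U \<subseteq> ?U \<union> {x, w}"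
  proof
    fix v assume "v \<in> E `` ?U"
    then obtain u where u: "u \<in> C" "dist E x u < dist E y u" "(u, v) \<in> E" by (auto simp: nearer_def)
    have "v \<noteq> y" using u C dist_edge[OF edge_sym[OF u(3)]] dist_eq_0_iff[of x u] by auto
    moreover have "v \<notin> {p, q}"
    proof
      assume "v \<in> {p, q}"
      then have "v \<in> C \<inter> nbrs x \<inter> nbrs y" using pq by blast
      moreover have "u \<in> nbrs v - {x, y}" using u C edge_sym[OF u(3)] by auto
      ultimately have "dist E x u = dist E y u" using common_nbr_fragment_nbr[OF frag] by simp
      then show False using u(2) by simp
    qed
    moreover have "v \<in> C \<union> {x, y}" using fragment_boundary[OF frag] u by blast
    ultimately show "v \<in> ?U \<union> {x, w}" using rest by blast
  qed
  moreover have "x \<noteq> w" "w \<notin> ?U" using w sub fragment_left_notin[OF frag] by blast+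
  ultimately have "fragment x w ?U"
    using few C w(1) nearer_subset[of x y C] unfolding fragment_def cuts_off_def by blast
  moreover have "?U \<subset> C" using nearer_subset[of x y C] sub by blast
  ultimately show False using minimal by (simp add: minimal_fragment_def)
qed

lemma cross_dist_sum_le:
  assumes frag: "fragment x y C"
  defines "D \<equiv> opposite x y C"
  shows "real (dist_sum E C D)
    \<le> real (card D) * real (sum (dist_from {x, y}) C)
      + real (card C) * real (sum (dist_from {x, y}) D) + 2 * real (crossing x y C D)"
proof -
  have "dist_sum E C D \<le> card D * sum (dist_from {x, y}) C + card C * sum (dist_from {x, y}) D
      + 2 * crossing x y C D"
    using fragmentD[OF frag] fragment_dist[OF frag]
    by (intro dist_sum_le_dist_from_pair) (auto simp: D_def)
  then have "real (dist_sum E C D)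
      \<le> real (card D * sum (dist_from {x, y}) C + card C * sum (dist_from {x, y}) D
        + 2 * crossing x y C D)"
    by (simp only: of_nat_le_iff)
  then show ?thesis by (simp only: of_nat_add of_nat_mult of_nat_numeral)
qed

lemma cross_dist_sum_le_minimal:
  assumes minimal: "minimal_fragment x y C"
  defines "D \<equiv> opposite x y C"
  assumes bound: "real (sum (dist_from {x, y}) D) \<le> d"
  shows "real (dist_sum E C D)
    \<le> real (card D) * ((real (card C) + 1) * (real (card C) + 2) / 6) + real (card C) * d
      + 2 * real (crossing x y C D)"
proof -
  have "real (card D) * real (sum (dist_from {x, y}) C)
      \<le> real (card D) * ((real (card C) + 1) * (real (card C) + 2) / 6)"
    using sum_dist_from_minimal_fragment_le[OF minimal] by (intro mult_left_mono) auto
  moreover have "real (card C) * real (sum (dist_from {x, y}) D) \<le> real (card C) * d"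
    using bound by (intro mult_left_mono) auto
  ultimately show ?thesis
    using cross_dist_sum_le[OF minimal_fragment_imp_fragment[OF minimal]]
    unfolding D_def by linarith
qed

lemma crossing_minimal_fragment:
  assumes minimal: "minimal_fragment x y C"
  defines "D \<equiv> opposite x y C"
  assumes card_C: "2 \<le> card C" and card_le: "card C \<le> card D"
    and degree: "\<forall>v\<in>V. 3 \<le> card (nbrs v)" and crossed: "crossing x y C D \<noteq> 0"
  shows "4 \<le> card C" "crossing x y C D \<le> (card C - 4) * (card D - 2)"
    "3 \<le> card {u\<in>D. dist_from {x, y} u = 1}"
proof -
  have "fragment x y C" using minimal by (rule minimal_fragment_imp_fragment)
  then have frag_D: "fragment x y D" unfolding D_def by (rule fragment_opposite)
  have card_D: "2 \<le> card D" using card_C card_le by linarith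
  note far = card_nearer_minimal_fragment[OF minimal card_C degree]
    card_nearer_minimal_fragment[OF minimal_fragment_commute[OF minimal] card_C degree]
  have "nearer x y C \<noteq> {} \<or> nearer y x C \<noteq> {}" using crossed by (auto simp: crossing_def)
  then show "4 \<le> card C" using far by linarith
  then have "card (nearer x y C) \<le> card C - 4" "card (nearer y x C) \<le> card C - 4"
    using far by auto
  then have "crossing x y C D
      \<le> (card C - 4) * card (nearer y x D) + (card C - 4) * card (nearer x y D)"
    unfolding crossing_def by (intro add_mono mult_right_mono) auto
  also have "\<dots> = (card C - 4) * (card (nearer x y D) + card (nearer y x D))"
    by (simp add: algebra_simps)
  also have "\<dots> \<le> (card C - 4) * (card D - 2)"
    using card_nearer_add_le[OF frag_D card_D] by (intro mult_left_mono) auto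
  finally show "crossing x y C D \<le> (card C - 4) * (card D - 2)" .
  have "nearer x y D \<noteq> {} \<or> nearer y x D \<noteq> {}" using crossed by (auto simp: crossing_def)
  then show "3 \<le> card {u\<in>D. dist_from {x, y} u = 1}"
    using nearer_narrow_fragment[OF frag_D card_D] by fastforce
qed

lemma cross_dist_sum_le_cross_bound_minimal:
  assumes minimal: "minimal_fragment x y C"
  defines "D \<equiv> opposite x y C"
  assumes card_C: "2 \<le> card C" and card_le: "card C \<le> card D"
    and degree: "\<forall>v\<in>V. 3 \<le> card (nbrs v)"
  shows "real (dist_sum E C D) \<le> cross_bound (real (card C)) (real (card D))"
proof -
  have frag: "fragment x y C" using minimal by (rule minimal_fragment_imp_fragment)
  then have frag_D: "fragment x y D" unfolding D_def by (rule fragment_opposite)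
  note cross = cross_dist_sum_le_minimal[OF minimal, folded D_def]
  show ?thesis
  proof (cases "crossing x y C D = 0")
    case True
    then show ?thesis
      using cross[OF sum_dist_from_fragment_le[OF frag_D]]
        cross_bound_ge_triple_layers[of "real (card C)" "real (card D)"]
        card_fragment_ge_3[OF frag card_C degree] card_le by simp
  next
    case False
    note crossing = crossing_minimal_fragment[OF minimal, folded D_def,
        OF card_C card_le degree False]
    have "real (crossing x y C D) \<le> real ((card C - 4) * (card D - 2))"
      using crossing(2) by (simp only: of_nat_le_iff)
    also have "\<dots> = (real (card C) - 4) * (real (card D) - 2)"
      using crossing(1) card_le by (simp add: of_nat_diff)
    finally show ?thesis
      using cross[OF sum_dist_from_wide_fragment_le[OF frag_D crossing(3)]]
        cross_bound_ge_triple_layers_wide[of "real (card C)" "real (card D)"] crossing(1) card_le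
      by simp
  qed
qed

end

section \<open>Vertices of degree 2\<close>

lemma wiener_bound_even:
  "even n \<Longrightarrow> 1 \<le> n \<Longrightarrow> wiener_bound n = wiener_bound (n - 1) + real n ^ 2 / 4"
  by (simp add: wiener_bound_def of_nat_diff power2_eq_square power3_eq_cube field_simps)

lemma wiener_bound_odd:
  "odd n \<Longrightarrow> wiener_bound n = wiener_bound (n - 1) + (real n - 1) ^ 2 / 4 + 2"
  by (cases n) (auto simp: wiener_bound_def power2_eq_square power3_eq_cube field_simps)

context connected_simple_graph
begin

definition ball :: "'a \<Rightarrow> nat \<Rightarrow> 'a set" where "ball v k = {u\<in>V. dist E v u < k}"

lemma ball_Suc: "ball v (Suc k) = ball v k \<union> layer v k"
  by (auto simp: ball_def layer_def)

lemma card_ball_Suc: "card (ball v (Suc k)) = card (ball v k) + card (layer v k)"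
  unfolding ball_Suc by (rule card_Un_disjoint) (auto simp: ball_def layer_def)

lemma card_ball_pair_layers:
  assumes "v \<in> V" "1 \<le> k" and "\<And>i. 1 \<le> i \<Longrightarrow> i < k \<Longrightarrow> card (layer v i) = 2"
  shows "card (ball v k) + 1 = 2 * k"
  using assms(2,3)
proof (induction k rule: nat_induct_at_least)
  case base
  have "ball v 1 = {v}" using assms(1) dist_eq_0_iff[of v] by (auto simp: ball_def)
  then show ?case by simp
next
  case (Suc k)
  then show ?case by (simp add: card_ball_Suc)
qed

lemma ball_eq_V:
  assumes "vertex_connected 2" "v \<in> V" "1 \<le> i" "card (layer v i) < 2"
  shows "ball v (Suc i) = V"
proof -
  have "dist E v u \<le> i" if "u \<in> V" for u
    using card_layer_ge[OF assms(1,2) that assms(3)] assms(4) by (meson not_le)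
  then show ?thesis by (auto simp: ball_def less_Suc_eq_le)
qed

lemma first_non_pair_layer:
  obtains t where "1 \<le> t" "card (layer v t) \<noteq> 2"
    "\<And>i. 1 \<le> i \<Longrightarrow> i < t \<Longrightarrow> card (layer v i) = 2"
proof -
  let ?P = "\<lambda>i. 1 \<le> i \<and> card (layer v i) \<noteq> 2"
  have "dist E v u \<le> status v" if "u \<in> V" for u
    unfolding status_def using that by (intro member_le_sum) auto
  then have "layer v (Suc (status v)) = {}" by (force simp: layer_def)
  then have "?P (Suc (status v))" by simp
  then have "?P (LEAST i. ?P i)" by (rule LeastI)
  moreover have "card (layer v i) = 2" if "1 \<le> i" "i < (LEAST i. ?P i)" for i
    using not_less_Least[OF that(2)] that(1) by simp
  ultimately show ?thesis using that[of "LEAST i. ?P i"] by simp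
qed

end

context linked_graph
begin

lemma first_non_pair_layer_odd:
  assumes v: "v \<in> V" "card (nbrs v) = 2" "card (layer v 2) \<le> 2" and n: "7 \<le> card V" "odd (card V)"
    and t: "1 \<le> t" "card (layer v t) \<noteq> 2"
    and pairs: "\<And>i. 1 \<le> i \<Longrightarrow> i < t \<Longrightarrow> card (layer v i) = 2"
  shows "3 \<le> t" "layer v t = {} \<or> 3 \<le> card (layer v t)"
proof -
  have card_V: "card V + 1 = 2 * t + card (layer v t)" if "card (layer v t) < 2"
    using ball_eq_V[OF vertex_connected_2 v(1) t(1) that] card_ball_Suc[of v t]
      card_ball_pair_layers[OF v(1) t(1) pairs] by simp
  have "t \<noteq> 1" using t(2) layer_1[OF v(1)] v(2) by auto
  moreover have "t \<noteq> 2"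
  proof
    assume "t = 2"
    then show False using card_V t(2) v(3) n(1) by simp
  qed
  ultimately show "3 \<le> t" using t(1) by linarith
  have "card (layer v t) \<noteq> 1" using card_V n(2) by presburger
  then have "card (layer v t) = 0 \<or> 3 \<le> card (layer v t)" using t(2) by linarith
  then show "layer v t = {} \<or> 3 \<le> card (layer v t)" by simp
qed

lemma nbrs_last_layer:
  assumes v: "v \<in> V" and w: "w \<in> layer v (Suc i)" and last: "ball v (Suc (Suc i)) = V"
  shows "nbrs w \<subseteq> layer v i"
proof
  fix z assume z: "z \<in> nbrs w"
  then have "z \<in> V" using edge_in_V by auto
  then have "z \<in> ball v (Suc (Suc i))" using last by simp
  then have "dist E v z \<le> Suc i" by (simp add: ball_def)
  moreover have "even (dist E v z) \<longleftrightarrow> odd (Suc i)"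
    using even_dist_edge[OF v, of w z] z w by (simp add: layer_def)
  then have "dist E v z \<noteq> Suc i" by auto
  moreover have "Suc i \<le> Suc (dist E v z)"
    using dist_edge_le[OF v edge_sym[of w z]] z w by (simp add: layer_def)
  ultimately show "z \<in> layer v i" using \<open>z \<in> V\<close> by (simp add: layer_def)
qed

lemma wide_degree_2_vertex_if_pair_layers:
  assumes v: "v \<in> V" and n: "6 \<le> card V" and i: "1 \<le> i"
    and pairs: "card (layer v i) = 2" "card (layer v (Suc i)) = 2"
    and last: "ball v (Suc (Suc i)) = V"
  obtains u where "u \<in> V" "card (nbrs u) = 2" "3 \<le> card (layer u 2)"
proof -
  obtain u u' where u: "layer v (Suc i) = {u, u'}" "u \<noteq> u'"
    using pairs(2) by (auto simp: card_2_iff)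
  then have uV: "u \<in> V" "u' \<in> V" using layer_subset_V[of v "Suc i"] by auto
  have nbrs: "nbrs w = layer v i" if "w \<in> {u, u'}" for w
    using nbrs_last_layer[OF v _ last, of w] degree_ge_2[of w] that uV u pairs(1)
    by (intro card_seteq) auto
  have two: "card (nbrs u) = 2" using nbrs[of u] pairs(1) by simp
  then obtain a where "a \<in> nbrs u" by (metis card.empty equals0I zero_neq_numeral)
  then have "(u, a) \<in> E" "(a, u') \<in> E" using nbrs[of u] nbrs[of u'] edge_sym by auto
  then have u': "u' \<in> layer u 2" using dist_eq_2 u(2) uV by (auto simp: layer_def)
  have "3 \<le> card (layer u 2)"
  proof (rule ccontr)
    let ?A = "nbrs u \<union> {u, u'}" and ?S = "layer u 2 - {u'}"
    assume "\<not> 3 \<le> card (layer u 2)"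
    then have few: "card ?S \<le> 1" using u' by simp
    have "card V \<le> card ?A + card ?S"
    proof (rule vertex_connected_card_V_le[OF vertex_connected_2])
      show "?A \<inter> ?S = {}" using nbrs_Int_layer_2[of u] by (auto simp: layer_def)
      show "E `` ?A \<subseteq> ?A \<union> ?S" using nbrs_nbrs_subset[of _ u] nbrs[of u] nbrs[of u'] by blast
      show "?A \<subseteq> V" "?S \<subseteq> V" using uV nbrs_subset_V layer_subset_V by blast+
    qed (use few in auto)
    moreover have "card ?A \<le> 4" using card_Un_le[of "nbrs u" "{u, u'}"] two u(2) by simp
    ultimately show False using few n by simp
  qed
  then show ?thesis using that uV(1) two by blast
qed

lemma opposite_ball:
  assumes "layer v s = {x, y}"
  shows "opposite x y (ball v s) = {u\<in>V. s < dist E v u}"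
  unfolding assms[symmetric] by (auto simp: ball_def layer_def)

lemma fragment_ball:
  assumes v: "v \<in> V" and s: "1 \<le> s" and xy: "layer v s = {x, y}" "x \<noteq> y"
    and ne: "layer v (Suc s) \<noteq> {}"
  shows "fragment x y (ball v s)"
proof -
  have "E `` ball v s \<subseteq> ball v s \<union> layer v s"
    unfolding ball_Suc[symmetric] using dist_edge_le[OF v] edge_in_V by (fastforce simp: ball_def)
  moreover have "v \<in> ball v s" using v s by (simp add: ball_def)
  moreover have "ball v s \<inter> layer v s = {}" by (auto simp: ball_def layer_def)
  moreover have "opposite x y (ball v s) \<noteq> {}"
    using ne unfolding opposite_ball[OF xy(1)] by (auto simp: layer_def)
  moreover have "ball v s \<subseteq> V" by (auto simp: ball_def)
  moreover have "x \<in> V" "y \<in> V" using xy(1) layer_subset_V[of v s] by auto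
  ultimately show ?thesis using xy(2) unfolding fragment_def cuts_off_def xy(1) by blast
qed

lemma first_layer_ball_subset:
  assumes v: "v \<in> V" and xy: "layer v (Suc s) = {x, y}" and frag: "fragment x y (ball v (Suc s))"
  shows "{u\<in>ball v (Suc s). dist_from {x, y} u = 1} \<subseteq> layer v s"
  unfolding first_layer_fragment[OF frag]
proof
  fix u assume u: "u \<in> ball v (Suc s) \<inter> (nbrs x \<union> nbrs y)"
  then obtain z where "z \<in> layer v (Suc s)" "(u, z) \<in> E" using xy edge_sym by auto
  then have "Suc s \<le> Suc (dist E v u)" using dist_edge_le[OF v, of u z] by (simp add: layer_def)
  then show "u \<in> layer v s" using u by (auto simp: ball_def layer_def)
qed

lemma layer_subset_first_layer_opposite_ball:
  assumes v: "v \<in> V" and xy: "layer v s = {x, y}" and frag: "fragment x y (ball v s)"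
  shows "layer v (Suc s) \<subseteq> {u\<in>opposite x y (ball v s). dist_from {x, y} u = 1}"
  unfolding first_layer_fragment[OF fragment_opposite[OF frag]]
proof
  fix u assume "u \<in> layer v (Suc s)"
  then have u: "u \<in> V" "dist E v u = Suc s" by (auto simp: layer_def)
  then obtain w where w: "(w, u) \<in> E" "dist E v w = s" using dist_SucE[OF v] by metis
  then have "w \<in> layer v s" using edge_in_V by (auto simp: layer_def)
  then show "u \<in> opposite x y (ball v s) \<inter> (nbrs x \<union> nbrs y)"
    using xy w(1) u unfolding opposite_ball[OF xy] by auto
qed

lemma cross_dist_sum_le_cross_bound_ball:
  assumes v: "v \<in> V" and i: "1 \<le> i" and pair: "card (layer v i) = 2"
    and xy: "layer v (Suc i) = {x, y}" "x \<noteq> y" and wide: "3 \<le> card (layer v (Suc (Suc i)))"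
  defines "C \<equiv> ball v (Suc i)"
  defines "D \<equiv> opposite x y C"
  shows "fragment x y C" "2 \<le> card C" "3 \<le> card D"
    "real (dist_sum E C D) \<le> cross_bound (real (card C)) (real (card D))"
proof -
  have "layer v (Suc (Suc i)) \<noteq> {}" using wide by auto
  then show frag: "fragment x y C" unfolding C_def using v xy by (intro fragment_ball) auto
  then have frag_D: "fragment x y D" unfolding D_def by (rule fragment_opposite)
  have fin: "finite C" "finite D" using frag frag_D by (auto intro: finite_fragment)
  have "layer v i \<subseteq> C" by (auto simp: C_def ball_def layer_def)
  then show card_C: "2 \<le> card C" using card_mono[OF fin(1), of "layer v i"] pair by simp
  have "layer v (Suc (Suc i)) \<subseteq> {u\<in>D. dist_from {x, y} u = 1}"
    using layer_subset_first_layer_opposite_ball[OF v xy(1)] frag by (simp add: C_def D_def)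
  then have wide_D: "3 \<le> card {u\<in>D. dist_from {x, y} u = 1}"
    using wide card_mono[of "{u\<in>D. dist_from {x, y} u = 1}" "layer v (Suc (Suc i))"] fin by simp
  then show card_D: "3 \<le> card D"
    using card_mono[OF fin(2), of "{u\<in>D. dist_from {x, y} u = 1}"] by auto
  have "card {u\<in>C. dist_from {x, y} u = 1} \<le> 2"
    using card_mono[OF finite_layer first_layer_ball_subset[OF v xy(1)]] frag pair
    by (simp add: C_def)
  then have uncrossed: "crossing x y C D = 0"
    using nearer_narrow_fragment[OF frag card_C] by (simp add: crossing_def)
  have "real (card D) * real (sum (dist_from {x, y}) C)
      \<le> real (card D) * ((real (card C) + 1) ^ 2 / 4)"
    using sum_dist_from_fragment_le[OF frag] by (intro mult_left_mono) auto
  moreover have "real (card C) * real (sum (dist_from {x, y}) D)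
      \<le> real (card C) * (real (card D) ^ 2 / 4 + 1)"
    using sum_dist_from_wide_fragment_le[OF frag_D wide_D] by (intro mult_left_mono) auto
  moreover have "real (card D) * ((real (card C) + 1) ^ 2 / 4)
      + real (card C) * (real (card D) ^ 2 / 4 + 1)
      \<le> cross_bound (real (card C)) (real (card D))"
    using card_C card_D by (intro cross_bound_ge_pair_layers) auto
  moreover have "real (dist_sum E C D) \<le> real (card D) * real (sum (dist_from {x, y}) C)
      + real (card C) * real (sum (dist_from {x, y}) D)"
    using cross_dist_sum_le[OF frag] uncrossed unfolding D_def[symmetric] by simp
  ultimately show "real (dist_sum E C D) \<le> cross_bound (real (card C)) (real (card D))" by linarith
qed

end

section \<open>The induction\<close>

locale linked_graph_induction = linked_graph V E for V :: "'a set" and E +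
  assumes large: "5 \<le> card V"
    and smaller: "\<lbrakk>linked_graph V' E'; 4 \<le> card V'; card (V' :: 'a set) < card V\<rbrakk>
      \<Longrightarrow> wiener V' E' \<le> wiener_bound (card V')"
begin

lemma dist_sum_delete_fragment_le:
  assumes frag: "fragment x y C" and D: "2 \<le> card (opposite x y C)"
  shows "real (dist_sum E (V - C) (V - C)) \<le> 2 * wiener_bound (card (opposite x y C) + 2)"
proof -
  let ?V = "V - C" and ?E = "Restr E (V - C)"
  have linked': "linked_graph ?V ?E" using frag D by (rule linked_graph_delete_fragment)
  then have connected': "connected_simple_graph ?V ?E" by (rule linked_graph.axioms)
  have "card ?V = card V - card C"
    using fragment_subset_V[OF frag] finite_fragment[OF frag] by (simp add: card_Diff_subset)
  then have card: "card ?V = card (opposite x y C) + 2" using card_V_fragment[OF frag] by simp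
  have "card C \<noteq> 0" using fragment_nonempty[OF frag] finite_fragment[OF frag] by simp
  then have "wiener ?V ?E \<le> wiener_bound (card ?V)"
    using smaller[OF linked'] card D card_V_fragment[OF frag] by simp
  moreover have "dist_sum E ?V ?V \<le> dist_sum ?E ?V ?V"
    unfolding dist_sum_def by (intro sum_mono dist_le_subgraph[OF _ connected']) auto
  ultimately show ?thesis using wiener_eq_dist_sum[of ?V ?E] unfolding card by linarith
qed

lemma wiener_le_fragment:
  assumes frag: "fragment x y C" and card_C: "2 \<le> card C" and card_D: "2 \<le> card (opposite x y C)"
  shows "wiener V E + 2 \<le> wiener_bound (card C + 2) + wiener_bound (card (opposite x y C) + 2)
    + real (dist_sum E C (opposite x y C))"
proof -
  let ?D = "opposite x y C"
  have V: "C \<union> {x, y} \<union> ?D = V" "C \<union> {x, y} = V - ?D" "{x, y} \<union> ?D = V - C"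
    using fragmentD[OF frag] by blast+
  have "dist_sum E (C \<union> {x, y} \<union> ?D) (C \<union> {x, y} \<union> ?D) + dist_sum E {x, y} {x, y}
      = dist_sum E (C \<union> {x, y}) (C \<union> {x, y}) + dist_sum E ({x, y} \<union> ?D) ({x, y} \<union> ?D)
        + 2 * dist_sum E C ?D"
    using fragmentD[OF frag] by (intro dist_sum_Un_Un) auto
  then have "dist_sum E V V + dist_sum E {x, y} {x, y}
      = dist_sum E (V - ?D) (V - ?D) + dist_sum E (V - C) (V - C) + 2 * dist_sum E C ?D"
    unfolding V(1) unfolding V(2,3) .
  moreover have "dist_sum E {x, y} {x, y} = 4"
    using fragment_dist[OF frag] dist_commute[of x y] fragment_ends_distinct[OF frag]
    by (simp add: dist_sum_def)
  moreover have "real (dist_sum E (V - C) (V - C)) \<le> 2 * wiener_bound (card ?D + 2)"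
    using frag card_D by (rule dist_sum_delete_fragment_le)
  moreover have "real (dist_sum E (V - ?D) (V - ?D)) \<le> 2 * wiener_bound (card C + 2)"
    using dist_sum_delete_fragment_le[OF fragment_opposite[OF frag]] card_C
    unfolding opposite_opposite[OF frag] by simp
  ultimately show ?thesis using wiener_eq_dist_sum[of V E] by linarith
qed

lemma wiener_le_cross_bound:
  assumes frag: "fragment x y C" and "2 \<le> card C" "2 \<le> card (opposite x y C)"
    and "card C \<le> card (opposite x y C) \<or> odd (card C) \<and> even (card (opposite x y C))"
    and "real (dist_sum E C (opposite x y C))
      \<le> cross_bound (real (card C)) (real (card (opposite x y C)))"
  shows "wiener V E \<le> wiener_bound (card V)"
  using wiener_le_fragment[OF assms(1-3)] cross_bound_le_wiener_bound[OF assms(2,4)] assms(5)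
  unfolding card_V_fragment[OF frag] by linarith

lemma wiener_le_minimum_fragment:
  assumes frag: "fragment x y C" and minimum: "\<And>r s A. fragment r s A \<Longrightarrow> card C \<le> card A"
    and degree: "\<forall>v\<in>V. 3 \<le> card (nbrs v)"
  shows "wiener V E \<le> wiener_bound (card V)"
proof -
  let ?D = "opposite x y C"
  have "card C \<noteq> 1"
  proof
    assume "card C = 1"
    then obtain c where c: "C = {c}" by (auto simp: card_1_singleton_iff)
    then have "nbrs c \<subseteq> {x, y}" using fragment_boundary[OF frag] by auto
    then have "card (nbrs c) \<le> card {x, y}" by (intro card_mono) auto
    moreover have "3 \<le> card (nbrs c)" using degree fragment_subset_V[OF frag] c by simp
    ultimately show False using fragment_ends_distinct[OF frag] by simp
  qed
  moreover have "card C \<noteq> 0" using fragment_nonempty[OF frag] finite_fragment[OF frag] by simp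
  ultimately have card_C: "2 \<le> card C" by linarith
  have card_D: "card C \<le> card ?D" using fragment_opposite[OF frag] by (rule minimum)
  have "\<not> fragment r s A" if "A \<subset> C" for r s A
    using minimum[of r s A] psubset_card_mono[OF finite_fragment[OF frag] that] by auto
  then have "minimal_fragment x y C" using frag by (simp add: minimal_fragment_def)
  then have "real (dist_sum E C ?D) \<le> cross_bound (real (card C)) (real (card ?D))"
    using card_C card_D degree by (rule cross_dist_sum_le_cross_bound_minimal)
  then show ?thesis using wiener_le_cross_bound[OF frag card_C] card_C card_D by simp
qed

lemma wiener_le_delete_degree_2:
  assumes v: "v \<in> V" "card (nbrs v) = 2"
  shows "wiener V E \<le> wiener_bound (card V - 1) + real (status v)"
proof -
  obtain a b where ab: "nbrs v = {a, b}" "a \<noteq> b" using v(2) by (auto simp: card_2_iff)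
  then have "(v, a) \<in> E" "(v, b) \<in> E" by blast+
  then have V: "a \<in> V" "b \<in> V" "a \<noteq> v" "b \<noteq> v" using edge_in_V by auto
  have "opposite a b {v} = V - {v, a, b}" "card {v, a, b} = 3" using ab(2) V by auto
  then have card: "card (opposite a b {v}) = card V - 3"
    using v(1) V by (simp add: card_Diff_subset)
  then have card': "card (opposite a b {v}) + 2 = card V - 1" using large by linarith
  have "card (opposite a b {v}) \<noteq> 0" using card large by simp
  then have "opposite a b {v} \<noteq> {}" by (metis card.empty)
  then have "fragment a b {v}"
    using v(1) V ab unfolding fragment_def cuts_off_def by auto
  then have "real (dist_sum E (V - {v}) (V - {v})) \<le> 2 * wiener_bound (card V - 1)"
    using dist_sum_delete_fragment_le[of a b "{v}"] card large unfolding card' by simp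
  moreover have "dist_sum E V V
      = dist_sum E {v} {v} + 2 * dist_sum E {v} (V - {v}) + dist_sum E (V - {v}) (V - {v})"
    using dist_sum_Un[of "{v}" "V - {v}"] v(1) by (simp add: insert_absorb)
  moreover have "dist_sum E {v} {v} = 0" "dist_sum E {v} (V - {v}) = status v"
    using status_eq[OF v(1)] by (simp_all add: dist_sum_def)
  ultimately show ?thesis using wiener_eq_dist_sum[of V E] by linarith
qed

lemma wiener_le_wide_degree_2:
  assumes v: "v \<in> V" "card (nbrs v) = 2" "3 \<le> card (layer v 2)" and n: "7 \<le> card V" "odd (card V)"
  shows "wiener V E \<le> wiener_bound (card V)"
proof -
  have "real (status v) \<le> real (card V - 1) + real (card V - 3) + layer_bound 2 (card V - 6)"
    using status_le_second[OF _ vertex_connected_2 v(1), of 2 3] v(2,3) by simp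
  then have "real (status v) \<le> (real (card V) - 1) ^ 2 / 4 + 2"
    using n by (simp add: layer_bound_2 of_nat_diff power2_eq_square field_simps)
  then show ?thesis using wiener_le_delete_degree_2[OF v(1,2)] wiener_bound_odd[OF n(2)] by simp
qed

lemma wiener_le_odd_degree_2:
  assumes v: "v \<in> V" "card (nbrs v) = 2" and n: "7 \<le> card V" "odd (card V)"
  shows "wiener V E \<le> wiener_bound (card V)"
proof (cases "3 \<le> card (layer v 2)")
  case True
  then show ?thesis using wiener_le_wide_degree_2 v n by blast
next
  case False
  then have thin: "card (layer v 2) \<le> 2" by simp
  obtain t where t: "1 \<le> t" "card (layer v t) \<noteq> 2"
    and pairs: "\<And>i. 1 \<le> i \<Longrightarrow> i < t \<Longrightarrow> card (layer v i) = 2"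
    by (rule first_non_pair_layer[of v]) blast
  note odd = first_non_pair_layer_odd[OF v thin n t pairs]
  define i where "i = t - 2"
  have i: "1 \<le> i" "t = Suc (Suc i)" using odd(1) by (auto simp: i_def)
  then have pair: "card (layer v i) = 2" "card (layer v (Suc i)) = 2" by (auto intro: pairs)
  from odd(2) show ?thesis
  proof
    assume empty: "layer v t = {}"
    then have "ball v (Suc t) = V" using t(1) v(1) by (intro ball_eq_V vertex_connected_2) auto
    then have "ball v (Suc (Suc i)) = V" using empty by (simp add: ball_Suc[of v t] flip: i(2))
    moreover have "6 \<le> card V" using n(1) by simp
    ultimately obtain u where "u \<in> V" "card (nbrs u) = 2" "3 \<le> card (layer u 2)"
      using wide_degree_2_vertex_if_pair_layers[OF v(1) _ i(1) pair] by metis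
    then show ?thesis using n by (rule wiener_le_wide_degree_2)
  next
    assume wide: "3 \<le> card (layer v t)"
    obtain x y where xy: "layer v (Suc i) = {x, y}" "x \<noteq> y" using pair(2) by (auto simp: card_2_iff)
    note ball = cross_dist_sum_le_cross_bound_ball[OF v(1) i(1) pair(1) xy wide[unfolded i(2)]]
    have "card (ball v (Suc i)) + 1 = 2 * Suc i"
      using v(1) i(2) by (intro card_ball_pair_layers pairs) auto
    then have "odd (card (ball v (Suc i)))" "even (card (opposite x y (ball v (Suc i))))"
      using card_V_fragment[OF ball(1)] n(2) by presburger+
    then show ?thesis using wiener_le_cross_bound[OF ball(1,2) _ _ ball(4)] ball(3) by simp
  qed
qed

lemma wiener_le_degree_2:
  assumes v: "v \<in> V" "card (nbrs v) = 2"
  shows "wiener V E \<le> wiener_bound (card V)"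
proof -
  note delete = wiener_le_delete_degree_2[OF v]
  have status: "real (status v) \<le> real (card V) ^ 2 / 4"
    using status_le[OF _ vertex_connected_2 v(1)] large by (simp add: layer_bound_2 of_nat_diff)
  consider (even) "even (card V)" | (five) "card V = 5" | (odd) "7 \<le> card V" "odd (card V)"
  proof -
    have "card V = 5 \<or> card V = 6 \<or> 7 \<le> card V" using large by linarith
    then show ?thesis using that by auto
  qed
  then show ?thesis
  proof cases
    case even
    then show ?thesis using delete status large wiener_bound_even[OF even] by simp
  next
    case five
    then have "real (status v) \<le> 25 / 4" using status by simp
    then have "status v \<le> 6" by linarith
    then have "real (status v) \<le> 6" by linarith
    then show ?thesis using delete wiener_bound_odd[of 5] unfolding five by simp
  next
    case odd
    with v show ?thesis by (rule wiener_le_odd_degree_2)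
  qed
qed

lemma wiener_le: "wiener V E \<le> wiener_bound (card V)"
proof (cases "\<exists>v\<in>V. card (nbrs v) = 2")
  case True
  then show ?thesis using wiener_le_degree_2 by blast
next
  case False
  then have degree: "3 \<le> card (nbrs v)" if "v \<in> V" for v
    using degree_ge_2[OF that] that by (force simp: le_less)
  show ?thesis
  proof (cases "vertex_connected 3")
    case True
    then show ?thesis using large by (intro wiener_le_3_connected) auto
  next
    case False
    then obtain x y C where "fragment x y C" "\<And>r s A. fragment r s A \<Longrightarrow> card C \<le> card A"
      by (rule minimum_fragment) blast
    then show ?thesis using degree by (intro wiener_le_minimum_fragment) auto
  qed
qed

end

lemma (in linked_graph) wiener_le_card_4:
  assumes "card V = 4"
  shows "wiener V E \<le> wiener_bound (card V)"
proof -
  have "real (status v) \<le> 4" if "v \<in> V" for v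
    using status_le[OF _ vertex_connected_2 that] assms by (simp add: layer_bound_2)
  then have "2 * wiener V E \<le> (\<Sum>v\<in>V. 4)" unfolding wiener_eq_sum_status by (rule sum_mono)
  then show ?thesis using assms by (simp add: wiener_bound_def)
qed

theorem wiener_le_linked_graph:
  fixes V :: "'a set"
  assumes "linked_graph V E" "4 \<le> card V"
  shows "wiener V E \<le> wiener_bound (card V)"
  using assms
proof (induction "card V" arbitrary: V E rule: less_induct)
  case less
  interpret linked_graph V E by (rule less.prems)
  show ?case
  proof (cases "card V = 4")
    case True
    then show ?thesis by (rule wiener_le_card_4)
  next
    case False
    interpret linked_graph_induction V E
    proof
      show "5 \<le> card V" using less.prems(2) False by simp
      show "wiener V' E' \<le> wiener_bound (card V')"
        if "linked_graph V' E'" "4 \<le> card V'" "card V' < card V" for V' :: "'a set" and E'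
        using less.hyps that by blast
    qed
    show ?thesis by (rule wiener_le)
  qed
qed

section \<open>Rotation systems\<close>

lemma odd_card_sym_diff:
  assumes "finite A" "finite B"
  shows "odd (card (sym_diff A B)) \<longleftrightarrow> odd (card A) \<noteq> odd (card B)"
proof -
  have "card (sym_diff A B) = card (A - B) + card (B - A)"
    using assms by (intro card_Un_disjoint) auto
  moreover have "card A = card (A \<inter> B) + card (A - B)" "card B = card (A \<inter> B) + card (B - A)"
    using assms card_Int_Diff[of A B] card_Int_Diff[of B A] by (auto simp: Int_commute)
  ultimately show ?thesis by auto
qed

lemma card_eq_kernel_times_image:
  assumes fin: "finite S" and closed: "\<And>A B. A \<in> S \<Longrightarrow> B \<in> S \<Longrightarrow> sym_diff A B \<in> S"
    and hom: "\<And>A B. A \<in> S \<Longrightarrow> B \<in> S \<Longrightarrow> \<Phi> (sym_diff A B) = sym_diff (\<Phi> A) (\<Phi> B)"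
  shows "card S = card {A\<in>S. \<Phi> A = {}} * card (\<Phi> ` S)"
proof -
  have fibre: "card {A\<in>S. \<Phi> A = y} = card {A\<in>S. \<Phi> A = {}}" if y: "y \<in> \<Phi> ` S" for y
  proof -
    obtain B where B: "B \<in> S" "\<Phi> B = y" using y by auto
    have "sym_diff B (sym_diff B A) = A" for A by auto
    then have "bij_betw (sym_diff B) {A\<in>S. \<Phi> A = y} {A\<in>S. \<Phi> A = {}}"
      by (intro bij_betw_byWitness[where f' = "sym_diff B"]) (use B closed hom in auto)
    then show ?thesis by (rule bij_betw_same_card)
  qed
  have "card S = (\<Sum>y\<in>\<Phi> ` S. card {A\<in>S. \<Phi> A = y})"
    using sum.image_gen[OF fin, of "\<lambda>_. 1::nat" \<Phi>] by simp
  also have "\<dots> = (\<Sum>y\<in>\<Phi> ` S. card {A\<in>S. \<Phi> A = {}})" using fibre by (intro sum.cong) auto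
  finally show ?thesis by simp
qed

locale rotation_graph = connected_simple_graph +
  fixes \<sigma> :: "'a \<times> 'a \<Rightarrow> 'a \<times> 'a"
  assumes rotation: "rotation_system E \<sigma>"
begin

abbreviation \<phi> :: "'a \<times> 'a \<Rightarrow> 'a \<times> 'a" where "\<phi> \<equiv> face_perm \<sigma>"

definition rot :: "'a \<Rightarrow> 'a \<Rightarrow> 'a" where "rot v p = snd (\<sigma> (v, p))"

lemma rotation_dart:
  assumes "(v, p) \<in> E"
  shows "\<sigma> (v, p) = (v, rot v p)" "(v, rot v p) \<in> E"
proof -
  have \<sigma>: "\<sigma> (v, p) \<in> E" "fst (\<sigma> (v, p)) = v"
    using rotation assms by (auto simp: rotation_system_def bij_betw_def)
  then show eq: "\<sigma> (v, p) = (v, rot v p)" by (simp add: rot_def prod_eq_iff)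
  show "(v, rot v p) \<in> E" using \<sigma>(1) unfolding eq .
qed

lemma nbrs_subset_rot_closed:
  assumes s: "s \<in> nbrs v" "s \<in> Z" and closed: "\<And>p. p \<in> nbrs v \<Longrightarrow> p \<in> Z \<Longrightarrow> rot v p \<in> Z"
  shows "nbrs v \<subseteq> Z"
proof
  fix q assume "q \<in> nbrs v"
  then obtain k where k: "(\<sigma> ^^ k) (v, s) = (v, q)"
    using rotation s(1) by (force simp: rotation_system_def)
  have "\<exists>p\<in>nbrs v \<inter> Z. (\<sigma> ^^ k) (v, s) = (v, p)" for k
    by (induction k) (use s closed rotation_dart in force)+
  then show "q \<in> Z" using k by (metis IntD2 prod.inject)
qed

lemma linked_at_if_rot_joined:
  assumes joined: "\<And>p. p \<in> nbrs v \<Longrightarrow> joined E v p (rot v p)"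
  shows "linked_at E v"
proof (rule linked_atI, rule ccontr)
  fix X Y
  assume XY: "X \<noteq> {}" "Y \<noteq> {}" "X \<inter> Y = {}" "X \<union> Y \<subseteq> nbrs v"
    and rest: "card (nbrs v - (X \<union> Y)) \<le> 1" and none: "\<not> (\<exists>p\<in>X. \<exists>q\<in>Y. joined E v p q)"
  let ?R = "nbrs v - (X \<union> Y)"
  have leaves: "\<exists>r\<in>?R. rot v r \<in> B"
    if "(A = X \<and> B = Y) \<or> (A = Y \<and> B = X)" for A B
  proof (rule ccontr)
    assume no: "\<not> ?thesis"
    have parts: "nbrs v = A \<union> ?R \<union> B" "B \<inter> (A \<union> ?R) = {}" "A \<noteq> {}" "B \<noteq> {}" using that XY by auto
    then obtain s where "s \<in> A" by blast
    have "nbrs v \<subseteq> A \<union> ?R"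
    proof (rule nbrs_subset_rot_closed)
      fix p assume p: "p \<in> nbrs v" "p \<in> A \<union> ?R"
      then have "rot v p \<in> nbrs v" using rotation_dart(2) by simp
      moreover have "rot v p \<notin> B"
      proof
        assume B: "rot v p \<in> B"
        then have "p \<in> A" using p no by blast
        then show False
          using B none joined[OF p(1)] joined_commute[of E v p "rot v p"] that by blast
      qed
      ultimately show "rot v p \<in> A \<union> ?R" using parts(1) by blast
    qed (use \<open>s \<in> A\<close> parts in blast)+
    then show False using parts by blast
  qed
  obtain r r' where "r \<in> ?R" "rot v r \<in> Y" "r' \<in> ?R" "rot v r' \<in> X"
    using leaves[of X Y] leaves[of Y X] by blast
  moreover from this have "r = r'" using rest by (auto simp: card_le_Suc0_iff_eq)
  ultimately show False using XY(3) by blast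
qed

subsection \<open>Faces\<close>

lemma face_perm_dart:
  assumes "(u, v) \<in> E"
  shows "\<phi> (u, v) = (v, rot v u)" "(v, rot v u) \<in> E"
  using rotation_dart[OF edge_sym[OF assms]] by (simp_all add: face_perm_def)

lemma fst_face_perm: "d \<in> E \<Longrightarrow> fst (\<phi> d) = snd d"
  using face_perm_dart by (cases d) simp

lemma finite_E [simp]: "finite E"
  using simple unfolding simple_graph_def by (meson finite_SigmaI finite_subset)

lemma bij_betw_face_perm: "bij_betw \<phi> E E"
proof -
  have "bij_betw prod.swap E E"
    by (rule bij_betw_byWitness[where f' = prod.swap]) (auto intro: edge_sym)
  moreover have "bij_betw \<sigma> E E" using rotation by (simp add: rotation_system_def)
  ultimately have "bij_betw (\<sigma> \<circ> prod.swap) E E" by (rule bij_betw_trans)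
  moreover have "\<sigma> \<circ> prod.swap = \<phi>" by (auto simp: face_perm_def prod.swap_def)
  ultimately show ?thesis by simp
qed

lemma face_of_refl: "d \<in> face_of \<sigma> d"
  unfolding face_of_def by (auto intro: exI[of _ 0])

lemma face_of_trans: "d' \<in> face_of \<sigma> d \<Longrightarrow> face_of \<sigma> d' \<subseteq> face_of \<sigma> d"
  by (auto simp: face_of_def simp flip: comp_apply[of "\<phi> ^^ _"] funpow_add)

lemma face_perm_in_face_of: "\<phi> d \<in> face_of \<sigma> d"
  unfolding face_of_def by (auto intro: exI[of _ 1])

lemma face_of_subset_E:
  assumes "d \<in> E"
  shows "face_of \<sigma> d \<subseteq> E"
proof -
  have "(\<phi> ^^ k) d \<in> E" for k
    using assms bij_betw_face_perm by (induction k) (auto simp: bij_betw_def)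
  then show ?thesis by (auto simp: face_of_def)
qed

lemma bij_betw_face_perm_face_of:
  assumes "d \<in> E"
  shows "bij_betw \<phi> (face_of \<sigma> d) (face_of \<sigma> d)"
proof -
  have inj: "inj_on \<phi> (face_of \<sigma> d)"
    using bij_betw_face_perm face_of_subset_E[OF assms]
    by (auto simp: bij_betw_def intro: inj_on_subset)
  have "\<phi> ` face_of \<sigma> d \<subseteq> face_of \<sigma> d" using face_perm_in_face_of face_of_trans by blast
  then have "\<phi> ` face_of \<sigma> d = face_of \<sigma> d"
    using finite_subset[OF face_of_subset_E[OF assms]] inj by (intro endo_inj_surj) auto
  then show ?thesis using inj by (simp add: bij_betw_def)
qed

lemma face_of_face_perm:
  assumes "d \<in> E"
  shows "face_of \<sigma> (\<phi> d) = face_of \<sigma> d"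
proof
  show "face_of \<sigma> (\<phi> d) \<subseteq> face_of \<sigma> d" using face_perm_in_face_of by (rule face_of_trans)
  obtain k where "d = \<phi> ((\<phi> ^^ k) d)"
    using bij_betw_face_perm_face_of[OF assms] face_of_refl[of d]
    by (auto simp: bij_betw_def face_of_def)
  then have "d \<in> face_of \<sigma> (\<phi> d)" by (auto simp: face_of_def funpow_swap1)
  then show "face_of \<sigma> d \<subseteq> face_of \<sigma> (\<phi> d)" by (rule face_of_trans)
qed

lemma face_of_eq:
  assumes "d \<in> E" "d' \<in> face_of \<sigma> d"
  shows "face_of \<sigma> d' = face_of \<sigma> d"
proof -
  have "(\<phi> ^^ k) d \<in> E \<and> face_of \<sigma> ((\<phi> ^^ k) d) = face_of \<sigma> d" for k
  proof (induction k)
    case (Suc k)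
    then show ?case using face_of_face_perm bij_betw_face_perm by (auto simp: bij_betw_def)
  qed (use assms in simp)
  moreover obtain k where "d' = (\<phi> ^^ k) d" using assms(2) by (auto simp: face_of_def)
  ultimately show ?thesis by simp
qed

lemma mem_face_iff:
  assumes "f \<in> faces E \<sigma>"
  shows "d \<in> f \<longleftrightarrow> d \<in> E \<and> f = face_of \<sigma> d"
proof -
  obtain e where "e \<in> E" "f = face_of \<sigma> e" using assms by (auto simp: faces_def)
  then show ?thesis using face_of_eq[of e d] face_of_subset_E[of e] face_of_refl[of d] by auto
qed

lemma finite_faces [simp]: "finite (faces E \<sigma>)" by (simp add: faces_def)

lemma finite_face: "f \<in> faces E \<sigma> \<Longrightarrow> finite f"
  using face_of_subset_E finite_subset[OF _ finite_E] by (auto simp: faces_def)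

subsection \<open>Cuts and face boundaries\<close>

definition undirected :: "'a \<times> 'a \<Rightarrow> 'a set" where "undirected d = {fst d, snd d}"

definition edges :: "'a set set" where "edges = undirected ` E"

definition edge_cut :: "'a set \<Rightarrow> 'a set set" where
  "edge_cut U = {e\<in>edges. e \<inter> U \<noteq> {} \<and> \<not> e \<subseteq> U}"

definition odd_faces :: "'a set set \<Rightarrow> ('a \<times> 'a) set set" where
  "odd_faces A = {f\<in>faces E \<sigma>. odd (card {d\<in>f. undirected d \<in> A})}"

abbreviation boundaries :: "('a \<times> 'a) set set set" where
  "boundaries \<equiv> odd_faces ` Pow edges"

lemma undirected_in_edges: "d \<in> E \<Longrightarrow> undirected d \<in> edges" by (simp add: edges_def)

lemma finite_edges [simp]: "finite edges" by (simp add: edges_def)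

lemma card_E: "card E = 2 * card edges"
proof -
  have "card {d\<in>E. undirected d = e} = 2" if "e \<in> edges" for e
  proof -
    obtain u v where uv: "(u, v) \<in> E" "e = {u, v}"
      using \<open>e \<in> edges\<close> by (auto simp: edges_def undirected_def)
    then have "{d\<in>E. undirected d = e} = {(u, v), (v, u)}"
      using edge_sym by (auto simp: undirected_def doubleton_eq_iff)
    moreover have "u \<noteq> v" using uv by auto
    ultimately show ?thesis by simp
  qed
  then have "(\<Sum>e\<in>undirected ` E. card {d\<in>E. undirected d = e}) = (\<Sum>e\<in>undirected ` E. 2)"
    by (intro sum.cong) (auto simp: edges_def)
  then show ?thesis
    using sum.image_gen[OF finite_E, of "\<lambda>_. 1::nat" undirected] by (simp add: edges_def)
qed

lemma undirected_in_edge_cut_iff: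
  "(u, v) \<in> E \<Longrightarrow> undirected (u, v) \<in> edge_cut U \<longleftrightarrow> (u \<in> U) \<noteq> (v \<in> U)"
  using undirected_in_edges[of "(u, v)"] by (auto simp: edge_cut_def undirected_def)

lemma edge_cut_sym_diff: "edge_cut (sym_diff A B) = sym_diff (edge_cut A) (edge_cut B)"
proof (rule set_eqI)
  fix e
  show "e \<in> edge_cut (sym_diff A B) \<longleftrightarrow> e \<in> sym_diff (edge_cut A) (edge_cut B)"
  proof (cases "e \<in> edges")
    case True
    then obtain u v where "(u, v) \<in> E" "e = undirected (u, v)" by (auto simp: edges_def)
    then show ?thesis by (auto simp: undirected_in_edge_cut_iff)
  qed (auto simp: edge_cut_def)
qed

lemma odd_faces_sym_diff: "odd_faces (sym_diff A B) = sym_diff (odd_faces A) (odd_faces B)"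
proof -
  have "odd (card {d\<in>f. undirected d \<in> sym_diff A B})
      \<longleftrightarrow> odd (card {d\<in>f. undirected d \<in> A}) \<noteq> odd (card {d\<in>f. undirected d \<in> B})"
    if "f \<in> faces E \<sigma>" for f
  proof -
    have "{d\<in>f. undirected d \<in> sym_diff A B}
        = sym_diff {d\<in>f. undirected d \<in> A} {d\<in>f. undirected d \<in> B}" by auto
    then show ?thesis
      using odd_card_sym_diff[of "{d\<in>f. undirected d \<in> A}" "{d\<in>f. undirected d \<in> B}"]
        finite_face[OF that] by simp
  qed
  then show ?thesis unfolding odd_faces_def by auto
qed

lemma odd_faces_edge_cut: "odd_faces (edge_cut U) = {}"
proof -
  have "even (card {d\<in>f. undirected d \<in> edge_cut U})" if f: "f \<in> faces E \<sigma>" for f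
  proof -
    let ?A = "{d\<in>f. fst d \<in> U}" and ?B = "{d\<in>f. fst (\<phi> d) \<in> U}"
    have "f \<subseteq> E" and bij: "bij_betw \<phi> f f"
      using f face_of_subset_E bij_betw_face_perm_face_of by (auto simp: faces_def)
    have "undirected d \<in> edge_cut U \<longleftrightarrow> (fst d \<in> U) \<noteq> (fst (\<phi> d) \<in> U)" if "d \<in> f" for d
    proof -
      have "d \<in> E" using that \<open>f \<subseteq> E\<close> by blast
      then show ?thesis
        using undirected_in_edge_cut_iff[of "fst d" "snd d" U] fst_face_perm[of d] by simp
    qed
    then have "{d\<in>f. undirected d \<in> edge_cut U} = sym_diff ?A ?B" by auto
    moreover have "bij_betw \<phi> ?B ?A" using bij by (rule bij_betw_Collect) simp
    then have "card ?B = card ?A" by (rule bij_betw_same_card)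
    ultimately show ?thesis using odd_card_sym_diff[of ?A ?B] finite_face[OF f] by simp
  qed
  then show ?thesis by (auto simp: odd_faces_def)
qed

lemma odd_faces_single:
  assumes "(u, v) \<in> E"
  shows "odd_faces {undirected (u, v)} = sym_diff {face_of \<sigma> (u, v)} {face_of \<sigma> (v, u)}"
proof -
  have vu: "(v, u) \<in> E" and ne: "u \<noteq> v" using assms edge_sym by auto
  have "odd (card {d\<in>f. undirected d = undirected (u, v)})
      \<longleftrightarrow> (f = face_of \<sigma> (u, v)) \<noteq> (f = face_of \<sigma> (v, u))" if f: "f \<in> faces E \<sigma>" for f
  proof -
    have "{d\<in>f. undirected d = undirected (u, v)}
        = (if (u, v) \<in> f then {(u, v)} else {}) \<union> (if (v, u) \<in> f then {(v, u)} else {})"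
      by (auto simp: undirected_def doubleton_eq_iff)
    then show ?thesis using mem_face_iff[OF f] assms vu ne by auto
  qed
  moreover have "face_of \<sigma> (u, v) \<in> faces E \<sigma>" "face_of \<sigma> (v, u) \<in> faces E \<sigma>"
    using assms vu by (auto simp: faces_def)
  ultimately show ?thesis unfolding odd_faces_def by auto
qed

lemma empty_in_boundaries: "{} \<in> boundaries"
  by (rule image_eqI[of _ _ "{}"]) (auto simp: odd_faces_def)

lemma sym_diff_in_boundaries:
  assumes "F \<in> boundaries" "G \<in> boundaries"
  shows "sym_diff F G \<in> boundaries"
proof -
  obtain A B where "A \<subseteq> edges" "B \<subseteq> edges" "F = odd_faces A" "G = odd_faces B" using assms by auto
  then have "sym_diff F G = odd_faces (sym_diff A B)" "sym_diff A B \<in> Pow edges"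
    by (auto simp only: odd_faces_sym_diff)
  then show ?thesis by blast
qed

definition homologous :: "'a \<times> 'a \<Rightarrow> 'a \<times> 'a \<Rightarrow> bool" where
  "homologous d e \<longleftrightarrow> sym_diff {face_of \<sigma> d} {face_of \<sigma> e} \<in> boundaries"

lemma homologous_refl: "homologous d d"
  using empty_in_boundaries by (simp add: homologous_def)

lemma homologous_reverse:
  assumes "(u, v) \<in> E" "homologous (u, v) d"
  shows "homologous (v, u) d"
proof -
  let ?f = "face_of \<sigma>"
  have "odd_faces {undirected (u, v)} \<in> boundaries"
    using assms(1) undirected_in_edges by (intro imageI) auto
  then have "sym_diff (sym_diff {?f (u, v)} {?f (v, u)}) (sym_diff {?f (u, v)} {?f d}) \<in> boundaries"
    unfolding odd_faces_single[OF assms(1)]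
    using assms(2) unfolding homologous_def by (rule sym_diff_in_boundaries)
  also have "sym_diff (sym_diff {?f (u, v)} {?f (v, u)}) (sym_diff {?f (u, v)} {?f d})
      = sym_diff {?f (v, u)} {?f d}" by auto
  finally show ?thesis by (simp only: homologous_def)
qed

lemma homologous_rot:
  assumes "(u, v) \<in> E" "homologous (u, v) d"
  shows "homologous (u, rot u v) d"
  using homologous_reverse[OF assms] face_of_face_perm[OF edge_sym[OF assms(1)]]
    face_perm_dart(1)[OF edge_sym[OF assms(1)]] by (simp add: homologous_def)

lemma homologous_nbrs:
  assumes "(u, v) \<in> E" "homologous (u, v) d" "(u, w) \<in> E"
  shows "homologous (u, w) d"
proof -
  have "nbrs u \<subseteq> {w. homologous (u, w) d}"
    by (rule nbrs_subset_rot_closed[of v]) (use assms homologous_rot in auto)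
  then show ?thesis using assms(3) by auto
qed

lemma homologous_if_darts:
  assumes d: "d \<in> E" and e: "e \<in> E"
  shows "homologous e d"
proof -
  let ?G = "{v\<in>V. \<forall>w\<in>nbrs v. homologous (v, w) d}"
  have "?G = V"
  proof (rule closed_eq_V)
    have "fst d \<in> ?G"
      using homologous_nbrs[of "fst d" "snd d" d] homologous_refl d
        edge_in_V[of "fst d" "snd d"] by auto
    then show "?G \<noteq> {}" by blast
    show "E `` ?G \<subseteq> ?G"
    proof
      fix w assume "w \<in> E `` ?G"
      then obtain v where "(v, w) \<in> E" "homologous (v, w) d" by auto
      then have "(w, v) \<in> E" "homologous (w, v) d" using edge_sym homologous_reverse by blast+
      then show "w \<in> ?G" using homologous_nbrs[of w v] edge_in_V[of w v] by simp
    qed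
  qed auto
  moreover have "fst e \<in> V" "snd e \<in> nbrs (fst e)" using e edge_in_V[of "fst e" "snd e"] by auto
  ultimately have "homologous (fst e, snd e) d" by blast
  then show ?thesis by simp
qed

lemma face_set_in_boundaries:
  assumes d: "d \<in> E" and F: "F \<subseteq> faces E \<sigma>"
  shows "F \<in> boundaries \<or> sym_diff F {face_of \<sigma> d} \<in> boundaries"
proof -
  have "finite F" using F finite_faces finite_subset by blast
  then show ?thesis using F
  proof (induction F)
    case empty
    then show ?case using empty_in_boundaries by simp
  next
    case (insert f F)
    then obtain e where "e \<in> E" "f = face_of \<sigma> e" by (auto simp: faces_def)
    then have f: "sym_diff {f} {face_of \<sigma> d} \<in> boundaries"
      using homologous_if_darts[OF d] by (simp add: homologous_def)
    have "sym_diff (insert f F) {face_of \<sigma> d} = sym_diff F (sym_diff {f} {face_of \<sigma> d})"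
      "insert f F = sym_diff (sym_diff F {face_of \<sigma> d}) (sym_diff {f} {face_of \<sigma> d})"
      using insert.hyps by auto
    then show ?case using insert.IH insert.prems sym_diff_in_boundaries f by (metis insert_subset)
  qed
qed

lemma card_edge_cuts_ge: "2 ^ card V \<le> 2 * card (edge_cut ` Pow V)"
proof -
  have "{U\<in>Pow V. edge_cut U = {}} \<subseteq> {{}, V}"
  proof
    fix U assume U: "U \<in> {U\<in>Pow V. edge_cut U = {}}"
    have "E `` U \<subseteq> U" using U undirected_in_edge_cut_iff by blast
    then show "U \<in> {{}, V}" using closed_eq_V[of U] U by auto
  qed
  then have "card {U\<in>Pow V. edge_cut U = {}} \<le> card {{}, V}" by (intro card_mono) auto
  also have "\<dots> \<le> 2" by (simp add: card_insert_if)
  finally have "card {U\<in>Pow V. edge_cut U = {}} \<le> 2" .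
  moreover have "card (Pow V) = card {U\<in>Pow V. edge_cut U = {}} * card (edge_cut ` Pow V)"
    by (rule card_eq_kernel_times_image) (use edge_cut_sym_diff in auto)
  ultimately show ?thesis by (simp add: card_Pow mult_right_mono)
qed

lemma card_boundaries_ge:
  assumes "d \<in> E"
  shows "2 ^ card (faces E \<sigma>) \<le> 2 * card boundaries"
proof -
  let ?shift = "\<lambda>F. sym_diff F {face_of \<sigma> d}"
  have "Pow (faces E \<sigma>) \<subseteq> boundaries \<union> ?shift ` boundaries"
  proof
    fix F assume "F \<in> Pow (faces E \<sigma>)"
    then have "F \<in> boundaries \<or> ?shift F \<in> boundaries"
      using face_set_in_boundaries[OF assms] by simp
    then show "F \<in> boundaries \<union> ?shift ` boundaries"
    proof
      assume "?shift F \<in> boundaries"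
      then have "?shift (?shift F) \<in> ?shift ` boundaries" by (rule imageI)
      also have "?shift (?shift F) = F" by auto
      finally show ?thesis by (rule UnI2)
    qed (rule UnI1)
  qed
  then have "card (Pow (faces E \<sigma>)) \<le> card (boundaries \<union> ?shift ` boundaries)"
    by (intro card_mono) auto
  also have "\<dots> \<le> card boundaries + card (?shift ` boundaries)" by (rule card_Un_le)
  also have "\<dots> \<le> card boundaries + card boundaries" by (intro add_left_mono card_image_le) auto
  finally show ?thesis by (simp add: card_Pow)
qed

text \<open>Over the field with two elements, connectedness of the graph and of its dual show that the
space of cuts has dimension \<open>n - 1\<close> and that of the edge sets meeting every face evenly has
dimension \<open>e - f + 1\<close>. By Euler's formula they agree, so the set of all edges is a cut.\<close>

theorem bipartite_if_plane_even_faces: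
  assumes plane: "plane_embedding V E \<sigma>" and even: "\<And>f. f \<in> faces E \<sigma> \<Longrightarrow> even (card f)"
  shows "bipartite E"
proof (cases "E = {}")
  case False
  then obtain d where d: "d \<in> E" by blast
  let ?Z = "{A\<in>Pow edges. odd_faces A = {}}" and ?f = "card (faces E \<sigma>)"
  have euler: "card V + ?f = card edges + 2"
    using plane card_E unfolding plane_embedding_def by simp
  have "card (Pow edges) = card ?Z * card boundaries"
    by (rule card_eq_kernel_times_image) (use odd_faces_sym_diff in auto)
  then have "2 ^ card edges = card ?Z * card boundaries" by (simp add: card_Pow)
  then have "2 * (card ?Z * (2 * card boundaries)) = 2 ^ card V * 2 ^ ?f"
    using euler by (simp flip: power_add)
  also have "\<dots> \<le> 2 * card (edge_cut ` Pow V) * 2 ^ ?f"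
    using card_edge_cuts_ge by (rule mult_right_mono) simp
  also have "\<dots> \<le> 2 * card (edge_cut ` Pow V) * (2 * card boundaries)"
    using card_boundaries_ge[OF d] by (rule mult_left_mono) simp
  finally have "card ?Z \<le> card (edge_cut ` Pow V) \<or> card boundaries = 0" by auto
  moreover have "card boundaries \<noteq> 0" using empty_in_boundaries by (subst card_0_eq) auto
  moreover have "edge_cut ` Pow V \<subseteq> ?Z" using odd_faces_edge_cut by (auto simp: edge_cut_def)
  ultimately have "edge_cut ` Pow V = ?Z" by (intro card_seteq) auto
  moreover have "{d\<in>f. undirected d \<in> edges} = f" if "f \<in> faces E \<sigma>" for f
    using mem_face_iff[OF that] undirected_in_edges by auto
  then have "edges \<in> ?Z" using even by (simp add: odd_faces_def)
  ultimately obtain U where "edge_cut U = edges" by (metis (no_types, lifting) imageE)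
  then have "(u \<in> U) \<noteq> (v \<in> U)" if "(u, v) \<in> E" for u v
    using undirected_in_edge_cut_iff[OF that, of U] undirected_in_edges[OF that] by simp
  then show ?thesis unfolding bipartite_def by (intro exI[of _ "\<lambda>u. u \<in> U"]) blast
qed (simp add: bipartite_def)

subsection \<open>Quadrangular faces\<close>

lemma card_face_4:
  assumes faces: "all_faces_4cycles E \<sigma>" and f: "f \<in> faces E \<sigma>"
  shows "card f = 4"
proof -
  obtain d where d: "d \<in> E" "f = face_of \<sigma> d" using f by (auto simp: faces_def)
  have period: "(\<phi> ^^ 4) d = d" and inj: "inj_on (\<lambda>i. fst ((\<phi> ^^ i) d)) {0..<4}"
    using faces d(1) by (auto simp: all_faces_4cycles_def)
  have "(\<phi> ^^ k) d \<in> (\<lambda>i. (\<phi> ^^ i) d) ` {0..<4}" for k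
    using funpow_mod_eq[OF period, of k] by (intro image_eqI[of _ _ "k mod 4"]) auto
  then have "f = (\<lambda>i. (\<phi> ^^ i) d) ` {0..<4}" by (auto simp: d(2) face_of_def)
  moreover have "inj_on (\<lambda>i. (\<phi> ^^ i) d) {0..<4}" using inj by (auto simp: inj_on_def)
  ultimately show ?thesis by (simp add: card_image)
qed

lemma rot_joined:
  assumes faces: "all_faces_4cycles E \<sigma>" and vp: "(v, p) \<in> E"
  shows "rot v p \<noteq> p" "joined E v p (rot v p)"
proof -
  define q where "q = rot v p"
  define w where "w = rot q v"
  have pv: "(p, v) \<in> E" using vp by (rule edge_sym)
  have vq: "\<phi> (p, v) = (v, q)" "(v, q) \<in> E" using face_perm_dart[OF pv] by (simp_all add: q_def)
  have qw: "\<phi> (v, q) = (q, w)" "(q, w) \<in> E" using face_perm_dart[OF vq(2)] by (simp_all add: w_def)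
  note wz = face_perm_dart[OF qw(2)]
  have "(\<phi> ^^ 4) (p, v) = (p, v)" and inj: "inj_on (\<lambda>i. fst ((\<phi> ^^ i) (p, v))) {0..<4}"
    using faces pv by (auto simp: all_faces_4cycles_def)
  then have "rot w q = p"
    using vq(1) qw(1) wz face_perm_dart[OF wz(2)] by (simp add: numeral_eq_Suc)
  then have "(p, w) \<in> E" using edge_sym[OF wz(2)] by simp
  moreover have "p \<noteq> q" using inj_onD[OF inj, of 0 2] vq(1) qw(1) by (auto simp: numeral_eq_Suc)
  moreover have "w \<noteq> v"
    using inj_onD[OF inj, of 1 3] vq(1) qw(1) wz(1) by (auto simp: numeral_eq_Suc)
  ultimately show "rot v p \<noteq> p" "joined E v p (rot v p)"
    using qw(2) joinedI[of w v p E q] by (auto simp: q_def)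
qed

lemma degree_ge_2_if_4cycles:
  assumes faces: "all_faces_4cycles E \<sigma>" and v: "v \<in> V" "2 \<le> card V"
  shows "2 \<le> card (nbrs v)"
proof -
  have "nbrs v \<noteq> {}"
  proof
    assume "nbrs v = {}"
    then have "{v} = V" using v(1) by (intro closed_eq_V) auto
    then have "card V = 1" by (metis card_1_singleton_iff One_nat_def)
    then show False using v(2) by simp
  qed
  then obtain p where p: "(v, p) \<in> E" by blast
  then have "card {p, rot v p} \<le> card (nbrs v)" using rotation_dart(2) by (intro card_mono) auto
  then show ?thesis using rot_joined(1)[OF faces p] by simp
qed

end

lemma quadrangulation_imp_linked_graph:
  assumes "quadrangulation V E" "2 \<le> card V"
  shows "linked_graph V E"
proof -
  obtain \<sigma> where \<sigma>: "plane_embedding V E \<sigma>" "all_faces_4cycles E \<sigma>"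
    and graph: "simple_graph V E" "connected_graph V E"
    using assms(1) by (auto simp: quadrangulation_def)
  interpret rotation_graph V E \<sigma>
    using \<sigma>(1) graph by unfold_locales (simp_all add: plane_embedding_def)
  show ?thesis
  proof
    show "bipartite E"
      using bipartite_if_plane_even_faces[OF \<sigma>(1)] card_face_4[OF \<sigma>(2)] by simp
    show "2 \<le> card (E `` {v})" if "v \<in> V" for v
      using \<sigma>(2) that assms(2) by (rule degree_ge_2_if_4cycles)
    show "linked_at E v" if "v \<in> V" for v
      using rot_joined(2)[OF \<sigma>(2)] by (intro linked_at_if_rot_joined) auto
  qed
qed

theorem theorem2:
  fixes V :: "'a set" and E :: "('a \<times> 'a) set"
  assumes "quadrangulation V E" and "card V \<ge> 4"
  shows "wiener V E \<le>
    (if even (card V)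
     then real (card V) ^ 3 / 12 + 7 / 6 * real (card V) - 2
     else real (card V) ^ 3 / 12 + 11 / 12 * real (card V) - 1)"
proof -
  have "linked_graph V E" using assms by (intro quadrangulation_imp_linked_graph) auto
  then have "wiener V E \<le> wiener_bound (card V)" using assms(2) by (rule wiener_le_linked_graph)
  then show ?thesis unfolding wiener_bound_def .
qed

end
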